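(* Let $d\in\mathbb{N}$, $s>1/2$ and $0<r\le\infty$. Then $$\lim_{n\to\infty}\frac{n^{s-1/2}\,a_n\big(I_d:H^{s,r}_{\mathrm{mix}}(\mathbb{T}^d)\to L_\infty(\mathbb{T}^d)\big)}{(\log n)^{(d-1)s}}=\frac{1}{\sqrt{2s-1}}\Big[\frac{2^d}{(d-1)!}\Big]^s.$$
   Context: $\mathbb{T}^d=[0,2\pi)^d$ is the $d$-dimensional torus with the normalized Lebesgue measure $(2\pi)^{-d}dx$. For $f\in L_1(\mathbb{T}^d)$, $\hat f(k)=(2\pi)^{-d}\int_{\mathbb{T}^d}f(x)e^{-ik\cdot x}dx$. For $s>0$ and $0<r\le\infty$, the Sobolev space of dominating mixed smoothness $H^{s,r}_{\mathrm{mix}}(\mathbb{T}^d)$ consists of all $f\in L_2(\mathbb{T}^d)$ with finite norm $\|f|H^{s,r}_{\mathrm{mix}}(\mathbb{T}^d)\|=\big(\sum_{k\in\mathbb{Z}^d}\prod_{j=1}^d(1+|k_j|^r)^{2s/r}|\hat f(k)|^2\big)^{1/2}$, where for $r=\infty$ the factor $(1+|k_j|^r)^{s/r}$ is interpreted as $\max(1,|k_j|)^s$. $\log$ is the natural logarithm, $I_d$ the inclusion map. For a bounded linear operator $T:X\to Y$ between Banach spaces, $a_n(T)=\inf\{\|T-A\|: A:X\to Y \text{ bounded linear},\ \operatorname{rank}A<n\}$. *)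

theory Defs
  imports "HOL-Analysis.Analysis" "HOL-Probability.Essential_Supremum"
begin

text \<open>The torus T^d is represented by the fundamental cube [0,2pi)^d in (real^'d);
  functions on T^d are complex-valued functions on (real^'d) considered on this cube.\<close>

definition torus_cube :: "(real^'d) set" where
  "torus_cube = {x. \<forall>i. 0 \<le> x$i \<and> x$i < 2 * pi}"

definition fcoeff :: "((real^'d) \<Rightarrow> complex) \<Rightarrow> (int^'d) \<Rightarrow> complex" where
  "fcoeff f k = complex_of_real (1 / (2 * pi) ^ CARD('d)) *
     integral\<^sup>L (lebesgue_on torus_cube)
       (\<lambda>x. f x * cis (- (\<Sum>i\<in>UNIV. real_of_int (k$i) * x$i)))"

definition L2_torus :: "((real^'d) \<Rightarrow> complex) \<Rightarrow> bool" where
  "L2_torus f \<longleftrightarrow> f \<in> borel_measurable (lebesgue_on torus_cube) \<and>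
     integrable (lebesgue_on torus_cube) (\<lambda>x. (cmod (f x))^2)"

definition mix_weight1 :: "ereal \<Rightarrow> int \<Rightarrow> real" where
  "mix_weight1 r k = (if r = \<infinity> then max 1 \<bar>real_of_int k\<bar>
     else (1 + \<bar>real_of_int k\<bar> powr real_of_ereal r) powr (1 / real_of_ereal r))"

definition mix_weight :: "real \<Rightarrow> ereal \<Rightarrow> (int^'d) \<Rightarrow> real" where
  "mix_weight s r k = prod (\<lambda>j. mix_weight1 r (k$j) powr (2 * s)) UNIV"

definition Hmix :: "real \<Rightarrow> ereal \<Rightarrow> ((real^'d) \<Rightarrow> complex) set" where
  "Hmix s r = {f. L2_torus f \<and>
      (\<lambda>k. mix_weight s r k * (cmod (fcoeff f k))^2) summable_on (UNIV :: (int^'d) set)}"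

definition Hmix_norm :: "real \<Rightarrow> ereal \<Rightarrow> ((real^'d) \<Rightarrow> complex) \<Rightarrow> real" where
  "Hmix_norm s r f = sqrt (\<Sum>\<^sub>\<infinity>k\<in>(UNIV :: (int^'d) set). mix_weight s r k * (cmod (fcoeff f k))^2)"

definition Linf_norm :: "((real^'d) \<Rightarrow> complex) \<Rightarrow> ereal" where
  "Linf_norm g = esssup (lebesgue_on torus_cube) (\<lambda>x. ereal (cmod (g x)))"

definition bounded_lin_functional :: "real \<Rightarrow> ereal \<Rightarrow> (((real^'d) \<Rightarrow> complex) \<Rightarrow> complex) \<Rightarrow> bool" where
  "bounded_lin_functional s r l \<longleftrightarrow>
     (\<forall>f\<in>Hmix s r. \<forall>h\<in>Hmix s r. \<forall>a b::complex. l (\<lambda>x. a * f x + b * h x) = a * l f + b * l h) \<and>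
     (\<exists>C. \<forall>f\<in>Hmix s r. cmod (l f) \<le> C * Hmix_norm s r f)"

text \<open>Bounded linear operators H^{s,r}_mix -> L_infinity of rank < n:
  A f = sum_{j<m} l_j(f) g_j with m < n, l_j bounded linear functionals and g_j in L_infinity.\<close>
definition finite_rank_op :: "real \<Rightarrow> ereal \<Rightarrow> nat \<Rightarrow>
    (((real^'d) \<Rightarrow> complex) \<Rightarrow> ((real^'d) \<Rightarrow> complex)) \<Rightarrow> bool" where
  "finite_rank_op s r n A \<longleftrightarrow> (\<exists>m<n. \<exists>g l.
      (\<forall>j<m. g j \<in> borel_measurable (lebesgue_on torus_cube) \<and> Linf_norm (g j) < \<infinity>) \<and>
      (\<forall>j<m. bounded_lin_functional s r (l j)) \<and>
      (\<forall>f x. A f x = (\<Sum>j<m. l j f * g j x)))"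

definition approx_number :: "('d::finite) itself \<Rightarrow> real \<Rightarrow> ereal \<Rightarrow> nat \<Rightarrow> ereal" where
  "approx_number _ s r n =
     (INF A \<in> {A :: ((real^'d) \<Rightarrow> complex) \<Rightarrow> ((real^'d) \<Rightarrow> complex). finite_rank_op s r n A}.
        SUP f \<in> {f \<in> Hmix s r. Hmix_norm s r f \<le> 1}. Linf_norm (\<lambda>x. f x - A f x))"

end

theory Submission
  imports Defs "HOL-Real_Asymp.Real_Asymp"
begin

text \<open>
  Let \<open>w(k)\<close> be the squared weight of the frequency \<open>k\<close>, and let \<open>e\<close> enumerate \<open>\<int>\<^sup>d\<close> so that \<open>w \<circ> e\<close> is
  nondecreasing. Then \<open>a\<^sub>n\<^sup>2 = (\<Sum>j \<ge> n - 1. 1 / w (e j))\<close>. The upper bound comes from the partial Fourier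
  sum over \<open>e 0, \<dots>, e (n - 2)\<close> and the Cauchy-Schwarz inequality. For the lower bound, let \<open>A\<close> have rank
  \<open>m < n\<close> and error at most \<open>B\<close>. Testing the error on all linear combinations of finitely many
  characters gives \<open>(\<Sum>k. |\<chi>\<^sub>k(x) - A \<chi>\<^sub>k(x)|\<^sup>2 / w(k)) \<le> B\<^sup>2\<close> for almost all \<open>x\<close>; integrated over the torus,
  this bounds the Hilbert-Schmidt error of the rank \<open>m\<close> operator \<open>A\<close> into \<open>L\<^sub>2\<close>, which is at least the
  sum of the \<open>1 / w(k)\<close> without the \<open>m\<close> largest ones.

  The number of \<open>k \<in> \<int>\<^sup>d\<close> with \<open>\<Prod>\<^sub>j (1 + |k\<^sub>j|\<^sup>r)\<^bsup>1/r\<^esup> \<le> R\<close> is asymptotically \<open>2\<^sup>d R (ln R)\<^bsup>d-1\<^esup> / (d-1)!\<close>, by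
  induction on \<open>d\<close>. Inverting this gives the growth of \<open>w (e j)\<close>, and summation by telescoping
  gives the growth of the tail sums.
\<close>

section \<open>Counting lattice points\<close>

text \<open>The obstacle in the lower bound is that an \<open>L_infinity\<close> error is controlled
  only almost everywhere, with a null set that depends on the test function. Coefficients from a
  countable dense set leave a single null set, and continuity then admits the optimal coefficients
  \<open>cnj (u k) / w k\<close> at every other point. After integration, Bessel's inequality keeps
  only finitely many frequencies, so the Hilbert-Schmidt estimate becomes linear algebra in finite
  dimension. The upper bound must identify f almost everywhere with its Fourier series; this rests
  on the uniqueness of Fourier coefficients, obtained from Stone-Weierstrass. Constants: put K = 2^d
  / (d-1)!, p = d-1, and let V be the product of the one-dimensional weights, so w = V^(2s).
  Counting gives V (e n) ~ n / (K (ln n)^p), where ln V (e n) ~ ln n is used. Hence 1 / w (e n) ~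
  K^(2s) n^(-2s) (ln n)^(2ps). Its tail is K^(2s) n^(1-2s) (ln n)^(2ps) / (2s-1) to leading order,
  and the square root gives the limit. All r lead to the same limit because counting sees the
  weights only through c k / k -> 1.\<close>

lemma power_diff_bounds:
  fixes x y :: real
  assumes "0 \<le> y" "y \<le> x"
  shows "real (Suc p) * y ^ p * (x - y) \<le> x ^ Suc p - y ^ Suc p"
    and "x ^ Suc p - y ^ Suc p \<le> real (Suc p) * x ^ p * (x - y)"
proof -
  have eq: "x ^ Suc p - y ^ Suc p = (x - y) * (\<Sum>i<Suc p. x ^ i * y ^ (p - i))"
    using diff_power_eq_sum[of x p y] by simp
  have lo: "y ^ p \<le> x ^ i * y ^ (p - i)" and hi: "x ^ i * y ^ (p - i) \<le> x ^ p" if "i < Suc p" for i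
  proof -
    have "y ^ p = y ^ i * y ^ (p - i)" "x ^ p = x ^ i * x ^ (p - i)"
      using that by (simp_all flip: power_add)
    moreover have "y ^ i * y ^ (p - i) \<le> x ^ i * y ^ (p - i)"
      using assms by (intro mult_right_mono power_mono) auto
    moreover have "x ^ i * y ^ (p - i) \<le> x ^ i * x ^ (p - i)"
      using assms by (intro mult_left_mono power_mono) auto
    ultimately show "y ^ p \<le> x ^ i * y ^ (p - i)" "x ^ i * y ^ (p - i) \<le> x ^ p" by simp_all
  qed
  have "(\<Sum>i<Suc p. y ^ p) \<le> (\<Sum>i<Suc p. x ^ i * y ^ (p - i))"
    by (intro sum_mono lo) auto
  hence "(x - y) * (real (Suc p) * y ^ p) \<le> (x - y) * (\<Sum>i<Suc p. x ^ i * y ^ (p - i))"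
    using assms by (intro mult_left_mono) auto
  thus "real (Suc p) * y ^ p * (x - y) \<le> x ^ Suc p - y ^ Suc p"
    unfolding eq by (simp only: mult_ac)
  have "(\<Sum>i<Suc p. x ^ i * y ^ (p - i)) \<le> (\<Sum>i<Suc p. x ^ p)"
    by (intro sum_mono hi) auto
  hence "(x - y) * (\<Sum>i<Suc p. x ^ i * y ^ (p - i)) \<le> (x - y) * (real (Suc p) * x ^ p)"
    using assms by (intro mult_left_mono) auto
  thus "x ^ Suc p - y ^ Suc p \<le> real (Suc p) * x ^ p * (x - y)"
    unfolding eq by (simp only: mult_ac)
qed

lemma ln_Suc_bounds:
  assumes "1 \<le> k"
  shows "1 / real (Suc k) \<le> ln (real (Suc k)) - ln (real k)"
    and "ln (real (Suc k)) - ln (real k) \<le> 1 / real k"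
proof -
  have k: "0 < real k" using assms by simp
  have "ln (real k / real (Suc k)) \<le> real k / real (Suc k) - 1"
    using k by (intro ln_le_minus_one) auto
  thus "1 / real (Suc k) \<le> ln (real (Suc k)) - ln (real k)"
    using k by (simp add: ln_div field_simps)
  have "ln (real (Suc k) / real k) \<le> real (Suc k) / real k - 1"
    using k by (intro ln_le_minus_one) auto
  thus "ln (real (Suc k)) - ln (real k) \<le> 1 / real k"
    using k by (simp add: ln_div field_simps)
qed

lemma real_le_of_le_nat_floor: "1 \<le> k \<Longrightarrow> k \<le> nat \<lfloor>R\<rfloor> \<Longrightarrow> real k \<le> R"
  by linarith

text \<open>Comparison of a decreasing sum with an integral: ln (R/t)^p / t has integral (ln
  R)^(p+1) / (p+1) over [1, R]. \<open>T k\<close> is p+1 times the part of this integral beyond k,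
  so its increments are squeezed between neighbouring summands.\<close>

lemma log_power_sum_bounds:
  fixes R :: real
  assumes "1 \<le> R"
  shows "\<bar>(\<Sum>k=1..nat \<lfloor>R\<rfloor>. ln (R / real k) ^ p / real k) - ln R ^ Suc p / real (Suc p)\<bar> \<le> ln R ^ p + 1"
proof -
  define h where "h k = ln (R / real k) ^ p / real k" for k
  define T where "T k = ln (R / real k) ^ Suc p" for k
  define K where "K = nat \<lfloor>R\<rfloor>"
  have K: "1 \<le> K" "real K \<le> R" "R < real K + 1"
    unfolding K_def using assms by (auto simp: le_nat_floor)
  have step: "real (Suc p) * h (Suc k) \<le> T k - T (Suc k) \<and> T k - T (Suc k) \<le> real (Suc p) * h k"
    if "1 \<le> k" "k < K" for k
  proof -
    have kR: "0 < real k" "real (Suc k) \<le> R" using that K by auto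
    define x y where "x = ln (R / real k)" and "y = ln (R / real (Suc k))"
    have xy: "x - y = ln (real (Suc k)) - ln (real k)"
      using kR assms by (simp add: x_def y_def ln_div)
    have y0: "0 \<le> y" unfolding y_def using kR by (simp add: field_simps)
    have yx: "y \<le> x" using xy ln_Suc_bounds[OF that(1)] by (smt (verit) divide_nonneg_nonneg of_nat_0_le_iff)
    have "real (Suc p) * h (Suc k) = real (Suc p) * y ^ p * (1 / real (Suc k))"
      by (simp add: h_def y_def)
    also have "\<dots> \<le> real (Suc p) * y ^ p * (x - y)"
      unfolding xy using ln_Suc_bounds[OF that(1)] y0 by (intro mult_left_mono) auto
    also have "\<dots> \<le> T k - T (Suc k)"
      using power_diff_bounds(1)[OF y0 yx] by (simp add: T_def x_def y_def)
    finally have 1: "real (Suc p) * h (Suc k) \<le> T k - T (Suc k)" .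
    have "T k - T (Suc k) \<le> real (Suc p) * x ^ p * (x - y)"
      using power_diff_bounds(2)[OF y0 yx] by (simp add: T_def x_def y_def)
    also have "\<dots> \<le> real (Suc p) * x ^ p * (1 / real k)"
      unfolding xy using ln_Suc_bounds[OF that(1)] y0 yx by (intro mult_left_mono) auto
    also have "\<dots> = real (Suc p) * h k" by (simp add: h_def x_def)
    finally show ?thesis using 1 by blast
  qed
  have tele: "(\<Sum>k=1..<n. T k - T (Suc k)) = T 1 - T n" if "1 \<le> n" for n
    using that by (induction n rule: nat_induct_at_least) auto
  have hK: "0 \<le> h K" unfolding h_def using K by (auto intro!: divide_nonneg_nonneg zero_le_power ln_ge_zero)
  \<comment> \<open>The sum ends at \<open>K\<close>, the integer part of \<open>R\<close>, so
    telescoping leaves \<open>T K\<close> over. Since R / K is at most 2, this remainder is at most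
    (ln 2)^(p+1), hence at most 1.\<close>
  have TK: "0 \<le> T K" "T K \<le> 1"
  proof -
    have "R / real K \<le> 2" using K by (simp add: field_simps)
    hence "ln (R / real K) \<le> ln 2" using K assms by (subst ln_le_cancel_iff) auto
    also have "\<dots> \<le> 1" using ln_le_minus_one[of "2::real"] by simp
    finally have "ln (R / real K) \<le> 1" .
    moreover have "0 \<le> ln (R / real K)" using K by (intro ln_ge_zero) auto
    ultimately show "0 \<le> T K" "T K \<le> 1" unfolding T_def by (auto intro: power_le_one simp del: power_Suc)
  qed
  have T1: "T 1 = ln R ^ Suc p" "h 1 = ln R ^ p" by (simp_all add: T_def h_def)
  \<comment> \<open>Splitting off the last term serves the lower bound, splitting off the first term
    the upper bound.\<close>
  have set1: "{1..K} = insert K {1..<K}" "{1..K} = insert 1 {Suc 1..<Suc K}" using K by auto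
  have sumA: "sum h {1..K} = h K + sum h {1..<K}" unfolding set1(1) by simp
  have "sum h {1..K} = h 1 + sum h {Suc 1..<Suc K}" unfolding set1(2) by simp
  hence sumB: "sum h {1..K} = h 1 + (\<Sum>k=1..<K. h (Suc k))" by (simp only: sum.shift_bounds_Suc_ivl)
  have "(\<Sum>k=1..<K. real (Suc p) * h (Suc k)) \<le> T 1 - T K"
    unfolding tele[OF K(1), symmetric] using step by (intro sum_mono) auto
  hence "real (Suc p) * (\<Sum>k=1..<K. h (Suc k)) \<le> ln R ^ Suc p"
    using TK T1 by (simp only: sum_distrib_left[symmetric])
  hence up: "sum h {1..K} \<le> ln R ^ p + ln R ^ Suc p / real (Suc p)"
    unfolding sumB T1 by (simp add: field_simps)
  have "T 1 - T K \<le> (\<Sum>k=1..<K. real (Suc p) * h k)"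
    unfolding tele[OF K(1), symmetric] using step by (intro sum_mono) auto
  hence "ln R ^ Suc p - 1 \<le> real (Suc p) * (\<Sum>k=1..<K. h k)"
    using TK T1 by (simp only: sum_distrib_left[symmetric])
  hence "(ln R ^ Suc p - 1) / real (Suc p) \<le> (\<Sum>k=1..<K. h k)"
    by (simp add: field_simps)
  moreover have "1 / real (Suc p) \<le> 1" by simp
  ultimately have "ln R ^ Suc p / real (Suc p) - 1 \<le> sum h {1..K}"
    unfolding sumA using hK by (simp only: diff_divide_distrib)
  moreover have "0 \<le> ln R ^ p" using assms by auto
  ultimately show ?thesis using up unfolding h_def K_def by linarith
qed

text \<open>The asymptotics of \<open>F\<close> must be applied at all arguments R/k, including
  those near 1. There monotonicity bounds \<open>F\<close>, and the additive constant absorbs the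
  bounded range.\<close>

lemma tendsto_xlnx_imp_bound:
  fixes F :: "real \<Rightarrow> real"
  assumes F: "((\<lambda>u. F u / (u * ln u ^ p)) \<longlongrightarrow> A) at_top" and mono: "mono F" and "0 < \<epsilon>"
  obtains C where "0 \<le> C" "\<And>u. 1 \<le> u \<Longrightarrow> \<bar>F u - A * (u * ln u ^ p)\<bar> \<le> \<epsilon> * (u * ln u ^ p) + C"
proof -
  from tendstoD[OF F \<open>0 < \<epsilon>\<close>] obtain U where U: "\<And>u. U \<le> u \<Longrightarrow> \<bar>F u / (u * ln u ^ p) - A\<bar> < \<epsilon>"
    by (auto simp: eventually_at_top_linorder dist_real_def)
  \<comment> \<open>The 2 keeps \<open>ln u\<close> positive beyond \<open>V\<close>, so that
    division by the comparison function is legitimate.\<close>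
  define V where "V = max U 2"
  define C where "C = \<bar>F 1\<bar> + \<bar>F V\<bar> + \<bar>A\<bar> * (V * ln V ^ p)"
  have C0: "0 \<le> C" unfolding C_def V_def by simp
  have "\<bar>F u - A * (u * ln u ^ p)\<bar> \<le> \<epsilon> * (u * ln u ^ p) + C" if "1 \<le> u" for u
  proof (cases "V \<le> u")
    case True
    hence q: "0 < u * ln u ^ p" unfolding V_def by auto
    have "\<bar>F u / (u * ln u ^ p) - A\<bar> \<le> \<epsilon>" using U[of u] True by (auto simp: V_def)
    hence "\<bar>F u / (u * ln u ^ p) - A\<bar> * (u * ln u ^ p) \<le> \<epsilon> * (u * ln u ^ p)"
      using q by (intro mult_right_mono) auto
    moreover have "\<bar>F u / (u * ln u ^ p) - A\<bar> * (u * ln u ^ p) = \<bar>(F u / (u * ln u ^ p) - A) * (u * ln u ^ p)\<bar>"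
      using q by (intro abs_mult_pos) auto
    moreover have "(F u / (u * ln u ^ p) - A) * (u * ln u ^ p) = F u - A * (u * ln u ^ p)"
      using q unfolding left_diff_distrib by (metis less_irrefl nonzero_eq_divide_eq)
    ultimately show ?thesis using C0 by simp
  next
    case False
    have "\<bar>F u\<bar> \<le> \<bar>F 1\<bar> + \<bar>F V\<bar>"
      using monoD[OF mono, of 1 u] monoD[OF mono, of u V] that False by linarith
    moreover have q: "0 \<le> u * ln u ^ p" using that by auto
    moreover have "u * ln u ^ p \<le> V * ln V ^ p"
      using that False by (intro mult_mono power_mono) auto
    hence "\<bar>A\<bar> * (u * ln u ^ p) \<le> \<bar>A\<bar> * (V * ln V ^ p)" by (intro mult_left_mono) auto
    moreover have "\<bar>A * (u * ln u ^ p)\<bar> = \<bar>A\<bar> * (u * ln u ^ p)" using q by (intro abs_mult_pos[symmetric])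
    moreover have "0 \<le> \<epsilon> * (u * ln u ^ p)" by (rule mult_nonneg_nonneg[OF less_imp_le[OF \<open>0 < \<epsilon>\<close>] q])
    ultimately show ?thesis unfolding C_def by linarith
  qed
  with C0 show thesis using that by blast
qed

text \<open>Inserting A u (ln u)^p for \<open>F\<close> turns the sum into A R times the sum of
  \<open>log_power_sum_bounds\<close>, which yields one more logarithm and the factor 1/(p+1). The
  additive constant in the bound for \<open>F\<close> occurs at most R times and is negligible
  against R (ln R)^(p+1). Iterated over the dimension, the factors 1/(p+1) build the
  factorial.\<close>

lemma tendsto_sum_quotients:
  fixes F :: "real \<Rightarrow> real"
  assumes F: "((\<lambda>u. F u / (u * ln u ^ p)) \<longlongrightarrow> A) at_top" and mono: "mono F"
  shows "((\<lambda>R. (\<Sum>k=1..nat \<lfloor>R\<rfloor>. F (R / real k)) / (R * ln R ^ Suc p)) \<longlongrightarrow> A / real (Suc p)) at_top"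
proof (rule tendstoI)
  fix e :: real assume e: "0 < e"
  obtain C where C: "0 \<le> C" "\<And>u. 1 \<le> u \<Longrightarrow> \<bar>F u - A * (u * ln u ^ p)\<bar> \<le> e / 2 * (u * ln u ^ p) + C"
    using tendsto_xlnx_imp_bound[OF F mono, of "e/2"] e by (metis half_gt_zero)
  \<comment> \<open>\<open>D\<close> collects the coefficients of all errors of order (ln R)^p + 1:
    from replacing \<open>S\<close> by \<open>M\<close> in the main term, from doing so in the
    relative error, and from the additive constant.\<close>
  define D where "D = \<bar>A\<bar> + e / 2 + C"
  have "((\<lambda>R::real. D * (ln R ^ p + 1) / ln R ^ Suc p) \<longlongrightarrow> 0) at_top"
  proof -
    have "((\<lambda>R::real. D * (1 / ln R + 1 / ln R ^ Suc p)) \<longlongrightarrow> D * (0 + 0)) at_top"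
      by (intro tendsto_intros) real_asymp+
    hence "((\<lambda>R::real. D * (1 / ln R + 1 / ln R ^ Suc p)) \<longlongrightarrow> 0) at_top" by simp
    moreover have "eventually (\<lambda>R::real. D * (1 / ln R + 1 / ln R ^ Suc p) = D * (ln R ^ p + 1) / ln R ^ Suc p) at_top"
      using eventually_gt_at_top[of 1] by eventually_elim (simp add: field_simps)
    ultimately show ?thesis by (rule Lim_transform_eventually)
  qed
  from tendstoD[OF this, of "e/2"] e
  have "eventually (\<lambda>R::real. \<bar>D * (ln R ^ p + 1) / ln R ^ Suc p\<bar> < e / 2) at_top"
    by (simp add: dist_real_def)
  thus "eventually (\<lambda>R. dist ((\<Sum>k=1..nat \<lfloor>R\<rfloor>. F (R / real k)) / (R * ln R ^ Suc p)) (A / real (Suc p)) < e) at_top"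
    using eventually_gt_at_top[of 1]
  proof eventually_elim
    case (elim R)
    define L S H where "L = ln R" and "S = (\<Sum>k=1..nat \<lfloor>R\<rfloor>. ln (R / real k) ^ p / real k)"
      and "H = (\<Sum>k=1..nat \<lfloor>R\<rfloor>. F (R / real k))"
    have L: "0 < L" using elim by (simp add: L_def)
    have R: "1 < R" by fact
    have Rk: "1 \<le> R / real k" if "k \<in> {1..nat \<lfloor>R\<rfloor>}" for k
    proof -
      have "real k \<le> R" using that by (intro real_le_of_le_nat_floor) auto
      thus ?thesis using that by (simp add: field_simps)
    qed
    have "\<bar>H - A * (R * S)\<bar> = \<bar>\<Sum>k=1..nat \<lfloor>R\<rfloor>. (F (R / real k) - A * (R / real k * ln (R / real k) ^ p))\<bar>"
      by (simp add: H_def S_def sum_subtractf sum_distrib_left mult_ac)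
    also have "\<dots> \<le> (\<Sum>k=1..nat \<lfloor>R\<rfloor>. e / 2 * (R / real k * ln (R / real k) ^ p) + C)"
      using C(2)[OF Rk] by (intro order.trans[OF sum_abs] sum_mono) auto
    also have "\<dots> = e / 2 * (R * S) + real (nat \<lfloor>R\<rfloor>) * C"
      by (simp add: S_def sum.distrib sum_distrib_left mult_ac)
    also have "real (nat \<lfloor>R\<rfloor>) * C \<le> R * C" using R C(1) by (intro mult_right_mono) auto
    finally have 1: "\<bar>H - A * (R * S)\<bar> \<le> e / 2 * (R * S) + R * C" by simp
    have S: "\<bar>S - L ^ Suc p / real (Suc p)\<bar> \<le> L ^ p + 1"
      using log_power_sum_bounds[of R p] R by (simp add: S_def L_def)
    define M where "M = L ^ Suc p / real (Suc p)"
    have M_le: "M \<le> L ^ Suc p"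
    proof -
      have "L ^ Suc p * 1 \<le> L ^ Suc p * real (Suc p)" using L by (intro mult_left_mono) auto
      thus ?thesis unfolding M_def by (simp add: field_simps)
    qed
    have 2: "\<bar>H / R - A * S\<bar> \<le> e / 2 * S + C"
    proof -
      have "\<bar>H / R - A * S\<bar> = \<bar>H - A * (R * S)\<bar> / R"
      proof -
        have "H / R - A * S = (H - A * (R * S)) / R" using R by (simp add: field_simps)
        thus ?thesis using R by (simp add: abs_divide)
      qed
      also have "\<dots> \<le> (e / 2 * (R * S) + R * C) / R" using 1 R by (intro divide_right_mono) auto
      also have "\<dots> = e / 2 * S + C" using R by (simp add: field_simps)
      finally show ?thesis .
    qed
    have "\<bar>A * S - A * M\<bar> \<le> \<bar>A\<bar> * (L ^ p + 1)"
      using S unfolding M_def[symmetric] right_diff_distrib[symmetric] abs_mult by (intro mult_left_mono) auto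
    moreover have "e / 2 * S \<le> e / 2 * (L ^ Suc p + (L ^ p + 1))"
      using S M_le e unfolding M_def[symmetric] by (intro mult_left_mono) auto
    moreover have "C * 1 \<le> C * (L ^ p + 1)" using C L by (intro mult_left_mono) auto
    ultimately have "\<bar>H / R - A * M\<bar> \<le> e / 2 * L ^ Suc p + D * (L ^ p + 1)"
      using 2 unfolding D_def by (simp only: ring_distribs)
    hence "\<bar>H / R - A * M\<bar> / L ^ Suc p \<le> (e / 2 * L ^ Suc p + D * (L ^ p + 1)) / L ^ Suc p"
      using L by (intro divide_right_mono) auto
    also have "\<dots> = e / 2 + D * (L ^ p + 1) / L ^ Suc p" using L by (simp add: add_divide_distrib)
    also have "\<dots> < e" using elim unfolding L_def by linarith
    finally have 3: "\<bar>H / R - A * M\<bar> / L ^ Suc p < e" .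
    have "\<bar>H / R - A * M\<bar> / L ^ Suc p = \<bar>(H / R - A * M) / L ^ Suc p\<bar>"
      using L by (simp add: abs_mult)
    also have "(H / R - A * M) / L ^ Suc p = H / (R * L ^ Suc p) - A / real (Suc p)"
      using L R unfolding M_def by (simp add: diff_divide_distrib)
    finally show ?case using 3 by (simp add: dist_real_def H_def L_def)
  qed
qed

text \<open>Passing from the weights \<open>k\<close> to asymptotically equivalent weights \<open>c k\<close>; the term \<open>k = 0\<close>
  and the finitely many \<open>k\<close> with \<open>c k > (1 + \<delta>) k\<close> contribute only \<open>O(F R)\<close>.\<close>
lemma tendsto_sum_quotients_perturbed:
  fixes F :: "real \<Rightarrow> real" and c :: "nat \<Rightarrow> real"
  assumes mono: "mono F" and nonneg: "\<And>u. 0 \<le> F u"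
    and small: "((\<lambda>u. F u / (u * ln u ^ p)) \<longlongrightarrow> 0) at_top"
    and H: "((\<lambda>R. (\<Sum>k=1..nat \<lfloor>R\<rfloor>. F (R / real k)) / (R * ln R ^ p)) \<longlongrightarrow> B) at_top"
    and zero: "\<And>u. u < 1 \<Longrightarrow> F u = 0"
    and c0: "1 \<le> c 0" and ck: "\<And>k. real k \<le> c k" and clim: "(\<lambda>k. c k / real k) \<longlonglongrightarrow> 1"
  shows "((\<lambda>R. (F (R / c 0) + 2 * (\<Sum>k=1..nat \<lfloor>R\<rfloor>. F (R / c k))) / (R * ln R ^ p)) \<longlongrightarrow> 2 * B) at_top"
proof -
  define q :: "real \<Rightarrow> real" where "q R = R * ln R ^ p" for R
  define h where "h R = (\<Sum>k=1..nat \<lfloor>R\<rfloor>. F (R / real k))" for R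
  define g where "g R = (\<Sum>k=1..nat \<lfloor>R\<rfloor>. F (R / c k))" for R
  have h_lim: "((\<lambda>R. h R / q R) \<longlongrightarrow> B) at_top" using H by (simp add: h_def q_def)
  have small': "((\<lambda>R. F R / q R) \<longlongrightarrow> 0) at_top" using small by (simp add: q_def)
  have q_pos: "0 < q R" if "1 < R" for R using that by (simp add: q_def)
  have gh: "g R \<le> h R" if "1 < R" for R
    unfolding g_def h_def
  proof (intro sum_mono monoD[OF mono] divide_left_mono)
    fix k assume k: "k \<in> {1..nat \<lfloor>R\<rfloor>}"
    show "real k \<le> c k" by (rule ck)
    show "0 \<le> R" using that by simp
    show "0 < c k * real k" using k order.trans[OF _ ck[of k], of 1] by simp
  qed
  \<comment> \<open>The upper estimate \<open>gh\<close> is immediate from \<open>c k\<close> being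
    at least k. For the lower one R is shrunk by the factor 1 + \<delta>, which compensates c k < (1
    + \<delta>) k for large k and changes the limit only by 1 / (1 + \<delta>).\<close>
  have lower: "eventually (\<lambda>R. B / (1 + \<delta>) - \<delta> < g R / q R) at_top" if d: "0 < \<delta>" for \<delta>
  proof -
    have "eventually (\<lambda>k. c k / real k < 1 + \<delta>) sequentially"
      using order_tendstoD(2)[OF clim, of "1+\<delta>"] d by simp
    then obtain K where K: "\<And>k. K \<le> k \<Longrightarrow> c k / real k < 1 + \<delta>"
      by (auto simp: eventually_sequentially)
    \<comment> \<open>Each of the fewer than \<open>K\<close> exceptional indices contributes at
      most \<open>F R\<close>.\<close>
    have main: "h (R / (1 + \<delta>)) - real K * F R \<le> g R" if R: "1 < R" for R
    proof -
      have "F (R / (1 + \<delta>) / real k) \<le> F (R / c k) + (if k < K then F R else 0)" if k: "1 \<le> k" for k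
      proof (cases "k < K")
        case True
        have "R / (1 + \<delta>) / real k \<le> R / 1"
          unfolding divide_divide_eq_left using d k R
          by (intro divide_left_mono) (auto intro!: mult_ge1_I)
        thus ?thesis using monoD[OF mono, of "R / (1 + \<delta>) / real k" R] nonneg[of "R / c k"] True by simp
      next
        case False
        have "c k \<le> (1 + \<delta>) * real k" using K[of k] False k by (simp add: field_simps)
        moreover have "0 < c k" using k ck[of k] by linarith
        ultimately have "R / (1 + \<delta>) / real k \<le> R / c k"
          unfolding divide_divide_eq_left using d k R by (intro divide_left_mono) auto
        thus ?thesis using monoD[OF mono] False by simp
      qed
      hence "h (R / (1 + \<delta>)) \<le> (\<Sum>k=1..nat \<lfloor>R / (1 + \<delta>)\<rfloor>. F (R / c k) + (if k < K then F R else 0))"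
        unfolding h_def by (intro sum_mono) auto
      also have "\<dots> \<le> (\<Sum>k=1..nat \<lfloor>R\<rfloor>. F (R / c k) + (if k < K then F R else 0))"
      proof (intro sum_mono2)
        have "R / (1 + \<delta>) \<le> R" using d R by (simp add: field_simps)
        thus "{1..nat \<lfloor>R / (1 + \<delta>)\<rfloor>} \<subseteq> {1..nat \<lfloor>R\<rfloor>}" by (auto intro: order.trans nat_mono floor_mono)
      qed (auto simp: nonneg)
      also have "\<dots> = g R + (\<Sum>k=1..nat \<lfloor>R\<rfloor>. if k < K then F R else 0)"
        by (simp add: g_def sum.distrib)
      also have "(\<Sum>k=1..nat \<lfloor>R\<rfloor>. if k < K then F R else 0) = (\<Sum>k\<in>{k\<in>{1..nat \<lfloor>R\<rfloor>}. k < K}. F R)"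
        by (subst sum.inter_filter) auto
      also have "\<dots> \<le> (\<Sum>k<K. F R)" by (intro sum_mono2) (auto simp: nonneg)
      finally show ?thesis by simp
    qed
    have "filterlim (\<lambda>R. R / (1 + \<delta>)) at_top at_top" using d by real_asymp
    from filterlim_compose[OF h_lim this]
    have 1: "((\<lambda>R. h (R / (1 + \<delta>)) / q (R / (1 + \<delta>))) \<longlongrightarrow> B) at_top" .
    \<comment> \<open>Together with 1 / (1 + \<delta>), the p-th power of this ratio is
      \<open>q (R / (1 + \<delta>)) / q R\<close>, the price of normalising by
      \<open>q R\<close>.\<close>
    have "((\<lambda>R. ln (R / (1 + \<delta>)) / ln R) \<longlongrightarrow> 1) at_top" using d by real_asymp
    from tendsto_mult[OF tendsto_const tendsto_power[OF this, of p], of "1 / (1 + \<delta>)"]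
    have 2: "((\<lambda>R. 1 / (1 + \<delta>) * (ln (R / (1 + \<delta>)) / ln R) ^ p) \<longlongrightarrow> 1 / (1 + \<delta>)) at_top" by simp
    have 3: "((\<lambda>R. h (R / (1 + \<delta>)) / q (R / (1 + \<delta>)) * (1 / (1 + \<delta>) * (ln (R / (1 + \<delta>)) / ln R) ^ p)
              - real K * (F R / q R)) \<longlongrightarrow> B * (1 / (1 + \<delta>)) - real K * 0) at_top"
      by (intro tendsto_diff tendsto_mult 1 2 small' tendsto_const)
    have "eventually (\<lambda>R. B / (1 + \<delta>) - \<delta> < h (R / (1 + \<delta>)) / q (R / (1 + \<delta>)) * (1 / (1 + \<delta>) * (ln (R / (1 + \<delta>)) / ln R) ^ p)
              - real K * (F R / q R)) at_top"
      using order_tendstoD(1)[OF 3, of "B / (1 + \<delta>) - \<delta>"] d by simp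
    thus ?thesis using eventually_gt_at_top[of "1 + \<delta>"]
    proof eventually_elim
      case (elim R)
      have R: "1 < R" "1 < R / (1 + \<delta>)" using elim d by (simp_all add: field_simps)
      have "h (R / (1 + \<delta>)) / q (R / (1 + \<delta>)) * (1 / (1 + \<delta>) * (ln (R / (1 + \<delta>)) / ln R) ^ p)
          = h (R / (1 + \<delta>)) / q R"
      proof -
        define Q l where "Q = R / (1 + \<delta>)" and "l = ln Q"
        have Q: "0 < Q" "0 < l" "1 / (1 + \<delta>) = Q / R" using R d by (simp_all add: Q_def l_def)
        have "h Q / (Q * l ^ p) * (Q / R * (l / ln R) ^ p) = h Q / (R * ln R ^ p)"
          using Q(1,2) by (simp add: power_divide)
        thus ?thesis unfolding q_def Q_def[symmetric] l_def[symmetric] Q(3) .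
      qed
      hence "B / (1 + \<delta>) - \<delta> < (h (R / (1 + \<delta>)) - real K * F R) / q R"
        using elim by (simp add: diff_divide_distrib)
      also have "\<dots> \<le> g R / q R" using main[OF R(1)] q_pos[OF R(1)] by (intro divide_right_mono) auto
      finally show ?case .
    qed
  qed
  have g_lim: "((\<lambda>R. g R / q R) \<longlongrightarrow> B) at_top"
  proof (rule order_tendstoI)
    fix a assume a: "a < B"
    have "((\<lambda>\<delta>. B / (1 + \<delta>) - \<delta>) \<longlongrightarrow> B / (1 + 0) - 0) (at_right (0::real))"
      by (intro tendsto_intros) auto
    hence "eventually (\<lambda>\<delta>. a < B / (1 + \<delta>) - \<delta>) (at_right (0::real))"
      using order_tendstoD(1)[of _ B _ a] a by simp
    moreover have "eventually (\<lambda>\<delta>. 0 < \<delta>) (at_right (0::real))" by (simp add: eventually_at_right_less)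
    ultimately have "eventually (\<lambda>\<delta>. 0 < \<delta> \<and> a < B / (1 + \<delta>) - \<delta>) (at_right (0::real))"
      by eventually_elim auto
    then obtain \<delta> where "0 < \<delta>" "a < B / (1 + \<delta>) - \<delta>"
      using eventually_happens[of _ "at_right (0::real)"] by auto
    thus "eventually (\<lambda>R. a < g R / q R) at_top"
      using lower[of \<delta>] by (auto elim: eventually_mono)
  next
    fix a assume a: "B < a"
    from order_tendstoD(2)[OF h_lim a] show "eventually (\<lambda>R. g R / q R < a) at_top"
      using eventually_gt_at_top[of 1]
    proof eventually_elim
      case (elim R)
      have "g R / q R \<le> h R / q R" using gh q_pos elim by (intro divide_right_mono) (auto intro: less_imp_le)
      thus ?case using elim by simp
    qed
  qed
  have z_lim: "((\<lambda>R. F (R / c 0) / q R) \<longlongrightarrow> 0) at_top"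
  proof (rule tendsto_sandwich[OF _ _ tendsto_const small'])
    show "eventually (\<lambda>R. 0 \<le> F (R / c 0) / q R) at_top"
      using eventually_gt_at_top[of 1] by eventually_elim (auto intro!: divide_nonneg_pos nonneg q_pos)
    show "eventually (\<lambda>R. F (R / c 0) / q R \<le> F R / q R) at_top"
      using eventually_gt_at_top[of 1]
    proof eventually_elim
      case (elim R)
      have "R / c 0 \<le> R / 1" using elim c0 by (intro divide_left_mono) auto
      thus ?case using monoD[OF mono, of "R / c 0" R] q_pos[of R] elim by (intro divide_right_mono) auto
    qed
  qed
  have "((\<lambda>R. F (R / c 0) / q R + 2 * (g R / q R)) \<longlongrightarrow> 0 + 2 * B) at_top"
    by (intro tendsto_intros z_lim g_lim)
  thus ?thesis by (simp add: q_def g_def add_divide_distrib)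
qed

text \<open>The dimension is a type in the theorem, so induction on it needs a function of a natural
  number. One coordinate is fixed at a time: the value 0, then the pairs of values k and -k. Cutting
  at the integer part of \<open>R\<close> is harmless when \<open>c k\<close> is at least k and 1,
  since a larger coordinate already makes the product exceed \<open>R\<close>.\<close>

fun lattice_count :: "(nat \<Rightarrow> real) \<Rightarrow> nat \<Rightarrow> real \<Rightarrow> real" where
  "lattice_count c 0 R = of_bool (1 \<le> R)"
| "lattice_count c (Suc d) R =
     lattice_count c d (R / c 0) + 2 * (\<Sum>k=1..nat \<lfloor>R\<rfloor>. lattice_count c d (R / c k))"

context
  fixes c :: "nat \<Rightarrow> real"
  assumes c_ge1: "\<And>k. 1 \<le> c k" and c_ge: "\<And>k. real k \<le> c k"
begin

lemma lattice_count_nonneg: "0 \<le> lattice_count c d R"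
  by (induction d arbitrary: R) (auto intro!: add_nonneg_nonneg sum_nonneg)

lemma lattice_count_eq_0: "R < 1 \<Longrightarrow> lattice_count c d R = 0"
proof (induction d arbitrary: R)
  case (Suc d)
  have "R / c k < 1" for k using Suc.prems c_ge1[of k] by (simp add: divide_less_eq)
  hence "lattice_count c d (R / c k) = 0" for k by (rule Suc.IH)
  thus ?case by simp
qed simp

lemma mono_lattice_count: "mono (lattice_count c d)"
proof (induction d)
  case 0
  show ?case by (auto simp: mono_def)
next
  case (Suc d)
  show ?case
  proof (rule monoI)
    fix x y :: real assume xy: "x \<le> y"
    have c_pos: "0 < c k" for k using c_ge1[of k] by simp
    have le: "lattice_count c d (x / c k) \<le> lattice_count c d (y / c k)" for k
      using xy c_pos[of k] by (intro monoD[OF Suc] divide_right_mono) auto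
    have "(\<Sum>k=1..nat \<lfloor>x\<rfloor>. lattice_count c d (x / c k)) \<le> (\<Sum>k=1..nat \<lfloor>x\<rfloor>. lattice_count c d (y / c k))"
      by (intro sum_mono le)
    also have "\<dots> \<le> (\<Sum>k=1..nat \<lfloor>y\<rfloor>. lattice_count c d (y / c k))"
      using xy by (intro sum_mono2) (auto simp: lattice_count_nonneg intro: order.trans nat_mono floor_mono)
    finally show "lattice_count c (Suc d) x \<le> lattice_count c (Suc d) y"
      using le[of 0] by simp
  qed
qed

text \<open>Passing from d+1 to d+2 coordinates multiplies the constant by 2, for the two signs, and
  by 1/(d+1), from the sum over quotients. The smallness condition on the boundary terms holds
  because the count in one dimension less lacks a logarithm.\<close>

lemma lattice_count_asymp:
  assumes clim: "(\<lambda>k. c k / real k) \<longlonglongrightarrow> 1"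
  shows "((\<lambda>R. lattice_count c (Suc d) R / (R * ln R ^ d)) \<longlongrightarrow> 2 ^ Suc d / fact d) at_top"
proof (induction d)
  case 0
  \<comment> \<open>In dimension one with \<open>c k\<close> replaced by k, the sum just counts the
    positive integers up to \<open>R\<close>.\<close>
  have "((\<lambda>R. (\<Sum>k=1..nat \<lfloor>R\<rfloor>. lattice_count c 0 (R / real k)) / (R * ln R ^ 0)) \<longlongrightarrow> 1) at_top"
  proof -
    have "((\<lambda>R::real. of_int \<lfloor>R\<rfloor> / R) \<longlongrightarrow> 1) at_top" by real_asymp
    moreover have "eventually (\<lambda>R::real. of_int \<lfloor>R\<rfloor> / R
        = (\<Sum>k=1..nat \<lfloor>R\<rfloor>. lattice_count c 0 (R / real k)) / (R * ln R ^ 0)) at_top"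
      using eventually_gt_at_top[of 1]
    proof eventually_elim
      case (elim R)
      have "(\<Sum>k=1..nat \<lfloor>R\<rfloor>. lattice_count c 0 (R / real k)) = (\<Sum>k=1..nat \<lfloor>R\<rfloor>. 1)"
        by (intro sum.cong) (auto simp: real_le_of_le_nat_floor)
      thus ?case using elim by simp
    qed
    ultimately show ?thesis by (rule Lim_transform_eventually)
  qed
  moreover have "((\<lambda>u. lattice_count c 0 u / (u * ln u ^ 0)) \<longlongrightarrow> 0) at_top"
  proof (rule Lim_transform_eventually)
    show "((\<lambda>u::real. 1 / u) \<longlongrightarrow> 0) at_top" by real_asymp
    show "eventually (\<lambda>u::real. 1 / u = lattice_count c 0 u / (u * ln u ^ 0)) at_top"
      using eventually_gt_at_top[of 1] by eventually_elim auto
  qed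
  ultimately have "((\<lambda>R. (lattice_count c 0 (R / c 0) + 2 * (\<Sum>k=1..nat \<lfloor>R\<rfloor>. lattice_count c 0 (R / c k)))
      / (R * ln R ^ 0)) \<longlongrightarrow> 2 * 1) at_top"
    using lattice_count_eq_0[of _ 0] lattice_count_nonneg[of 0] mono_lattice_count[of 0] c_ge1 c_ge clim
    by (intro tendsto_sum_quotients_perturbed) blast+
  thus ?case by simp
next
  case (Suc d)
  let ?F = "lattice_count c (Suc d)"
  have "((\<lambda>u. ?F u / (u * ln u ^ d) * (1 / ln u)) \<longlongrightarrow> 2 ^ Suc d / fact d * 0) at_top"
    by (intro tendsto_mult Suc) real_asymp
  hence small: "((\<lambda>u. ?F u / (u * ln u ^ Suc d)) \<longlongrightarrow> 0) at_top" by (simp add: mult_ac)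
  have "((\<lambda>R. (?F (R / c 0) + 2 * (\<Sum>k=1..nat \<lfloor>R\<rfloor>. ?F (R / c k))) / (R * ln R ^ Suc d))
     \<longlongrightarrow> 2 * (2 ^ Suc d / fact d / real (Suc d))) at_top"
    using lattice_count_eq_0 lattice_count_nonneg mono_lattice_count c_ge1 c_ge clim small
      tendsto_sum_quotients[OF Suc mono_lattice_count]
    by (intro tendsto_sum_quotients_perturbed) blast+
  thus ?case by (simp add: mult_ac)
qed

section \<open>Identification of the recursion with the number of lattice points\<close>

lemma sum_symmetric_int:
  fixes f :: "nat \<Rightarrow> real"
  shows "(\<Sum>m\<in>{-int K..int K}. f (nat \<bar>m\<bar>)) = f 0 + 2 * (\<Sum>k=1..K. f k)"
proof (induction K)
  case (Suc K)
  have "{-int (Suc K)..int (Suc K)} = insert (int (Suc K)) (insert (-int (Suc K)) {-int K..int K})"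
    by auto
  thus ?case using Suc by (simp add: nat_add_distrib)
qed simp

text \<open>Induction over the index set requires functions on subsets of the coordinates.
  Extensional functions carry no information outside \<open>J\<close>, so extending by one
  coordinate is a bijection onto the larger set.\<close>

lemma card_lattice_points_PiE:
  assumes "finite J"
  shows "finite {k \<in> J \<rightarrow>\<^sub>E (UNIV :: int set). (\<Prod>j\<in>J. c (nat \<bar>k j\<bar>)) \<le> R} \<and>
    real (card {k \<in> J \<rightarrow>\<^sub>E (UNIV :: int set). (\<Prod>j\<in>J. c (nat \<bar>k j\<bar>)) \<le> R}) = lattice_count c (card J) R"
  using assms
proof (induction J arbitrary: R rule: finite_induct)
  case empty
  show ?case by (cases "1 \<le> R") auto
next
  case (insert j J)
  define P where "P J R = {k \<in> J \<rightarrow>\<^sub>E (UNIV :: int set). (\<Prod>j\<in>J. c (nat \<bar>k j\<bar>)) \<le> R}" for J :: "'a set" and R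
  define K where "K = nat \<lfloor>R\<rfloor>"
  \<comment> \<open>The lattice points are fibred over the new coordinate m. The range from -K to K
    loses nothing: the other factors have product at least 1, so the constraint forces c (|m|),
    hence |m|, to be at most \<open>R\<close>.\<close>
  define Q where "Q = (SIGMA m:{-int K..int K}. P J (R / c (nat \<bar>m\<bar>)))"
  have IH: "finite (P J R)" "real (card (P J R)) = lattice_count c (card J) R" for R
    using insert.IH unfolding P_def by auto
  have c_pos: "0 < c k" for k using c_ge1[of k] by simp
  have eq: "P (insert j J) R = (\<lambda>(m, k). k(j := m)) ` Q"
  proof (intro equalityI subsetI)
    fix k assume k: "k \<in> P (insert j J) R"
    have prod: "c (nat \<bar>k j\<bar>) * (\<Prod>i\<in>J. c (nat \<bar>k i\<bar>)) \<le> R"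
      using k insert.hyps by (simp add: P_def)
    have ge1: "1 \<le> (\<Prod>i\<in>J. c (nat \<bar>k i\<bar>))" by (intro prod_ge_1 c_ge1)
    have "c (nat \<bar>k j\<bar>) * 1 \<le> c (nat \<bar>k j\<bar>) * (\<Prod>i\<in>J. c (nat \<bar>k i\<bar>))"
      using ge1 c_pos[of "nat \<bar>k j\<bar>"] by (intro mult_left_mono) auto
    hence "real (nat \<bar>k j\<bar>) \<le> R" using prod c_ge[of "nat \<bar>k j\<bar>"] by linarith
    hence "nat \<bar>k j\<bar> \<le> K" unfolding K_def by (simp add: le_nat_floor)
    hence "k j \<in> {-int K..int K}" by auto
    moreover have "k(j := undefined) \<in> P J (R / c (nat \<bar>k j\<bar>))"
    proof -
      have "(\<Prod>i\<in>J. c (nat \<bar>(k(j := undefined)) i\<bar>)) = (\<Prod>i\<in>J. c (nat \<bar>k i\<bar>))"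
        using insert.hyps by (intro prod.cong) auto
      moreover have "k(j := undefined) \<in> J \<rightarrow>\<^sub>E UNIV"
        using k insert.hyps unfolding P_def by (auto simp: PiE_def extensional_def)
      ultimately show ?thesis using prod c_pos[of "nat \<bar>k j\<bar>"] unfolding P_def
        by (simp add: field_simps)
    qed
    ultimately have "(k j, k(j := undefined)) \<in> Q" unfolding Q_def by simp
    moreover have "k = (\<lambda>(m, k). k(j := m)) (k j, k(j := undefined))" by simp
    ultimately show "k \<in> (\<lambda>(m, k). k(j := m)) ` Q" by blast
  next
    fix k assume "k \<in> (\<lambda>(m, k). k(j := m)) ` Q"
    then obtain m k' where k': "k = k'(j := m)" "k' \<in> P J (R / c (nat \<bar>m\<bar>))" unfolding Q_def by auto
    have "(\<Prod>i\<in>J. c (nat \<bar>(k'(j := m)) i\<bar>)) = (\<Prod>i\<in>J. c (nat \<bar>k' i\<bar>))"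
      using insert.hyps by (intro prod.cong) auto
    moreover have "k'(j := m) \<in> insert j J \<rightarrow>\<^sub>E UNIV"
      using k' unfolding P_def by (auto simp: PiE_def extensional_def)
    ultimately show "k \<in> P (insert j J) R"
      using k' insert.hyps c_pos[of "nat \<bar>m\<bar>"] unfolding P_def by (simp add: field_simps)
  qed
  have inj: "inj_on (\<lambda>(m, k). k(j := m)) Q"
  proof (rule inj_onI, clarsimp)
    fix m k m' k' assume a: "(m, k) \<in> Q" "(m', k') \<in> Q" "k(j := m) = k'(j := m')"
    have ext: "k j = undefined" "k' j = undefined"
      using a insert.hyps unfolding Q_def P_def by (auto simp: PiE_def extensional_def)
    have "m = m'" using fun_cong[OF a(3), of j] by simp
    moreover have "k x = k' x" for x using fun_cong[OF a(3), of x] ext by (cases "x = j") auto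
    ultimately show "m = m' \<and> k = k'" by auto
  qed
  have "finite Q" unfolding Q_def by (intro finite_SigmaI IH) auto
  hence fin: "finite (P (insert j J) R)" unfolding eq by simp
  have "real (card (P (insert j J) R)) = real (card Q)"
    unfolding eq using card_image[OF inj] by simp
  also have "\<dots> = (\<Sum>m\<in>{-int K..int K}. lattice_count c (card J) (R / c (nat \<bar>m\<bar>)))"
    unfolding Q_def using IH by (subst card_SigmaI) auto
  also have "\<dots> = lattice_count c (Suc (card J)) R"
    using sum_symmetric_int[of "\<lambda>k. lattice_count c (card J) (R / c k)" K] by (simp add: K_def)
  finally show ?case using fin insert.hyps unfolding P_def by simp
qed

lemma card_lattice_points:
  "finite {k :: int^'d. (\<Prod>j\<in>UNIV. c (nat \<bar>k $ j\<bar>)) \<le> R}"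
  "real (card {k :: int^'d. (\<Prod>j\<in>UNIV. c (nat \<bar>k $ j\<bar>)) \<le> R}) = lattice_count c CARD('d) R"
proof -
  let ?P = "{k \<in> (UNIV :: 'd set) \<rightarrow>\<^sub>E (UNIV :: int set). (\<Prod>j\<in>UNIV. c (nat \<bar>k j\<bar>)) \<le> R}"
  have "{k :: int^'d. (\<Prod>j\<in>UNIV. c (nat \<bar>k $ j\<bar>)) \<le> R} = vec_lambda ` ?P"
  proof (intro equalityI subsetI)
    fix k :: "int^'d" assume "k \<in> {k. (\<Prod>j\<in>UNIV. c (nat \<bar>k $ j\<bar>)) \<le> R}"
    hence "vec_nth k \<in> ?P" by simp
    moreover have "k = vec_lambda (vec_nth k)" by simp
    ultimately show "k \<in> vec_lambda ` ?P" by blast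
  qed auto
  moreover have "inj_on vec_lambda ?P" by (auto simp: inj_on_def vec_lambda_inject)
  ultimately show "finite {k :: int^'d. (\<Prod>j\<in>UNIV. c (nat \<bar>k $ j\<bar>)) \<le> R}"
    "real (card {k :: int^'d. (\<Prod>j\<in>UNIV. c (nat \<bar>k $ j\<bar>)) \<le> R}) = lattice_count c CARD('d) R"
    using card_lattice_points_PiE[of "UNIV :: 'd set" R] by (simp_all add: card_image)
qed

end

section \<open>Sorted enumerations and tail sums\<close>

text \<open>Greedy choice: \<open>e n\<close> is a lightest element not yet chosen. An element never
  chosen would be at least as heavy as every chosen one, putting infinitely many elements into one
  finite sublevel set.\<close>

lemma ex_sorted_enumeration:
  fixes W :: "'a \<Rightarrow> real"
  assumes inf: "infinite (UNIV :: 'a set)" and fin: "\<And>t. finite {k. W k \<le> t}"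
  obtains e :: "nat \<Rightarrow> 'a" where "bij e" "\<And>m n. m \<le> n \<Longrightarrow> W (e m) \<le> W (e n)"
proof -
  define P where "P f n k \<longleftrightarrow> k \<notin> f ` {..<n} \<and> (\<forall>k'. k' \<notin> f ` {..<n} \<longrightarrow> W k \<le> W k')"
    for f :: "nat \<Rightarrow> 'a" and n :: nat and k
  have "\<exists>e. \<forall>n. P e n (e n)"
  proof (rule dependent_wf_choice)
    show "wf less_than" by simp
  next
    fix f g :: "nat \<Rightarrow> 'a" and n k
    assume "\<And>z. (z, n) \<in> less_than \<Longrightarrow> f z = g z"
    hence "f ` {..<n} = g ` {..<n}" by (intro image_cong) auto
    thus "P f n k = P g n k" unfolding P_def by simp
  next
    fix n and f :: "nat \<Rightarrow> 'a"
    have "infinite (- f ` {..<n})" using inf by (simp add: Compl_eq_Diff_UNIV)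
    then obtain k0 where k0: "k0 \<notin> f ` {..<n}" by (metis ComplD ex_in_conv finite.emptyI)
    \<comment> \<open>A minimum over all remaining elements need not exist a priori; the sublevel
      set of one remaining element \<open>k0\<close> makes the search finite and already contains
      all competitors.\<close>
    define S where "S = {k. W k \<le> W k0} - f ` {..<n}"
    have S: "finite S" "k0 \<in> S" unfolding S_def using fin k0 by auto
    then obtain k where k: "k \<in> S" "W k = Min (W ` S)"
      using Min_in[of "W ` S"] by (metis empty_iff finite_imageI image_iff image_is_empty)
    have "W k \<le> W k'" if "k' \<notin> f ` {..<n}" for k'
    proof (cases "k' \<in> S")
      case True
      thus ?thesis using k S by simp
    next
      case False
      thus ?thesis using that k(1) unfolding S_def by auto
    qed
    thus "\<exists>k. P f n k" using k(1) unfolding P_def S_def by blast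
  qed
  then obtain e where e: "\<And>n. P e n (e n)" by blast
  have neq: "e m \<noteq> e n" if "m < n" for m n
    using e[of n] that unfolding P_def by (metis imageI lessThan_iff)
  have inj: "inj e" unfolding inj_def by (metis neq linorder_neqE_nat)
  have "W (e n) \<le> W (e (Suc n))" for n
  proof -
    have "e (Suc n) \<notin> e ` {..<n}" using e[of "Suc n"] unfolding P_def by auto
    thus ?thesis using e[of n] unfolding P_def by blast
  qed
  hence mono: "m \<le> n \<Longrightarrow> W (e m) \<le> W (e n)" for m n by (rule lift_Suc_mono_le)
  have "surj e"
  proof (rule ccontr)
    assume "\<not> surj e"
    then obtain k where k: "k \<notin> range e" by blast
    have "range e \<subseteq> {k'. W k' \<le> W k}"
    proof clarify
      fix n show "W (e n) \<le> W k" using e[of n] k unfolding P_def by blast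
    qed
    hence "finite (range e)" using fin finite_subset by blast
    thus False using inj by (simp add: finite_image_iff)
  qed
  with inj mono show thesis using that unfolding bij_def by blast
qed

text \<open>Inversion of the counting function. The index n lies between the counts at
  \<open>v n - 1\<close> and at \<open>v n\<close>, and a shift of the radius by 1 does not change
  the asymptotics. Then ln (v n) is replaced by ln n.\<close>

lemma enumeration_asymp:
  fixes W :: "'a \<Rightarrow> real" and e :: "nat \<Rightarrow> 'a"
  assumes bij: "bij e" and mono: "\<And>m n. m \<le> n \<Longrightarrow> W (e m) \<le> W (e n)"
    and fin: "\<And>t. finite {k. W k \<le> t}"
    and N: "((\<lambda>R. real (card {k. W k \<le> R}) / (R * ln R ^ p)) \<longlongrightarrow> K) at_top" and K: "0 < K"
  shows "filterlim (\<lambda>n. W (e n)) at_top sequentially"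
    and "(\<lambda>n. real n / (W (e n) * ln (real n) ^ p)) \<longlonglongrightarrow> K"
proof -
  define v where "v n = W (e n)" for n
  define N where "N R = real (card {k. W k \<le> R})" for R
  define q :: "real \<Rightarrow> real" where "q R = R * ln R ^ p" for R
  have lim: "((\<lambda>R. N R / q R) \<longlongrightarrow> K) at_top" using N by (simp add: N_def q_def)
  have inj: "inj e" using bij by (simp add: bij_def)
  have v: "filterlim v at_top sequentially"
    unfolding filterlim_at_top
  proof
    fix Z
    have "finite (e -` {k. W k \<le> Z})" using fin inj by (intro finite_vimageI)
    hence "eventually (\<lambda>n. n \<notin> e -` {k. W k \<le> Z}) sequentially"
      by (auto simp: cofinite_eq_sequentially[symmetric] eventually_cofinite)
    thus "eventually (\<lambda>n. Z \<le> v n) sequentially" by eventually_elim (auto simp: v_def)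
  qed
  thus "filterlim (\<lambda>n. W (e n)) at_top sequentially" by (simp add: v_def[abs_def])
  have up: "real n \<le> N (v n)" for n
  proof -
    have "e ` {..<n} \<subseteq> {k. W k \<le> v n}" using mono by (auto simp: v_def)
    from card_mono[OF fin this] show ?thesis
      using card_image[OF inj_on_subset[OF inj subset_UNIV], of "{..<n}"] by (simp add: N_def)
  qed
  \<comment> \<open>Subtracting 1 makes the comparison strict, so ties at the value
    \<open>v n\<close> cannot spoil the count.\<close>
  have low: "N (v n - 1) \<le> real n" for n
  proof -
    have "{k. W k \<le> v n - 1} \<subseteq> e ` {..<n}"
    proof
      fix k assume k: "k \<in> {k. W k \<le> v n - 1}"
      obtain m where m: "k = e m" using bij by (metis bij_pointE)
      have "m < n"
      proof (rule ccontr)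
        assume "\<not> m < n"
        hence "v n \<le> W k" unfolding m v_def by (intro mono) auto
        thus False using k by simp
      qed
      thus "k \<in> e ` {..<n}" using m by blast
    qed
    from card_mono[OF _ this] show ?thesis
      using card_image_le[of "{..<n}" e] by (simp add: N_def)
  qed
  have v1: "eventually (\<lambda>n. 2 < v n) sequentially" using v by (simp add: filterlim_at_top_dense)
  have "(\<lambda>n. real n / q (v n)) \<longlonglongrightarrow> K"
  proof (rule tendsto_sandwich[where f = "\<lambda>n. N (v n - 1) / q (v n)" and h = "\<lambda>n. N (v n) / q (v n)"])
    show "(\<lambda>n. N (v n) / q (v n)) \<longlonglongrightarrow> K" by (rule filterlim_compose[OF lim v])
    have "filterlim (\<lambda>R::real. R - 1) at_top at_top" by real_asymp
    from filterlim_compose[OF lim this] have "((\<lambda>R. N (R - 1) / q (R - 1)) \<longlongrightarrow> K) at_top" .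
    moreover have "((\<lambda>R. (R - 1) / R * (ln (R - 1) / ln R) ^ p) \<longlongrightarrow> 1 * 1 ^ p) (at_top :: real filter)"
      by (intro tendsto_mult tendsto_power) real_asymp+
    ultimately have "((\<lambda>R. N (R - 1) / q (R - 1) * ((R - 1) / R * (ln (R - 1) / ln R) ^ p)) \<longlongrightarrow> K * (1 * 1 ^ p)) at_top"
      by (rule tendsto_mult)
    moreover have "eventually (\<lambda>R. N (R - 1) / q (R - 1) * ((R - 1) / R * (ln (R - 1) / ln R) ^ p) = N (R - 1) / q R) at_top"
      using eventually_gt_at_top[of 2] by eventually_elim (simp add: q_def power_divide)
    ultimately have "((\<lambda>R. N (R - 1) / q R) \<longlongrightarrow> K) at_top"
      using Lim_transform_eventually by fastforce
    thus "(\<lambda>n. N (v n - 1) / q (v n)) \<longlonglongrightarrow> K" using filterlim_compose v by blast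
    show "eventually (\<lambda>n. N (v n - 1) / q (v n) \<le> real n / q (v n)) sequentially"
      using v1 by eventually_elim (intro divide_right_mono low, auto simp: q_def)
    show "eventually (\<lambda>n. real n / q (v n) \<le> N (v n) / q (v n)) sequentially"
      using v1 by eventually_elim (intro divide_right_mono up, auto simp: q_def)
  qed
  note main = this
  \<comment> \<open>Taking logarithms in n ~ K v (ln v)^p gives ln n = ln v + p ln (ln v) + O(1),
    hence ln n ~ ln v.\<close>
  have "((\<lambda>n. ln (real n / q (v n)) / ln (v n) + 1 + real p * (ln (ln (v n)) / ln (v n))) \<longlonglongrightarrow> 0 + 1 + real p * 0)"
  proof (intro tendsto_intros)
    have "((\<lambda>R::real. ln (ln R) / ln R) \<longlongrightarrow> 0) at_top" by real_asymp
    thus "(\<lambda>n. ln (ln (v n)) / ln (v n)) \<longlonglongrightarrow> 0" using filterlim_compose v by blast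
    have "filterlim (ln :: real \<Rightarrow> real) at_top at_top" by (rule ln_at_top)
    hence "filterlim (\<lambda>n. ln (v n)) at_top sequentially" using filterlim_compose v by blast
    moreover have "(\<lambda>n. ln (real n / q (v n))) \<longlonglongrightarrow> ln K" using main K by (intro tendsto_ln) auto
    ultimately show "(\<lambda>n. ln (real n / q (v n)) / ln (v n)) \<longlonglongrightarrow> 0"
      using real_tendsto_divide_at_top by blast
  qed
  moreover have "eventually (\<lambda>n. ln (real n / q (v n)) / ln (v n) + 1 + real p * (ln (ln (v n)) / ln (v n)) = ln (real n) / ln (v n)) sequentially"
    using v1 eventually_gt_at_top[of 0]
  proof eventually_elim
    case (elim n)
    have pos: "0 < ln (v n)" using elim by simp
    have "ln (real n / q (v n)) = ln (real n) - ln (v n) - real p * ln (ln (v n))"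
      using elim pos by (simp add: q_def ln_div ln_mult ln_realpow)
    thus ?case using pos by (simp add: field_simps)
  qed
  ultimately have ln_lim: "(\<lambda>n. ln (real n) / ln (v n)) \<longlonglongrightarrow> 1"
    using Lim_transform_eventually by fastforce
  have "(\<lambda>n. (real n / q (v n)) / (ln (real n) / ln (v n)) ^ p) \<longlonglongrightarrow> K / 1 ^ p"
    by (intro tendsto_intros main ln_lim) auto
  moreover have "eventually (\<lambda>n. (real n / q (v n)) / (ln (real n) / ln (v n)) ^ p = real n / (v n * ln (real n) ^ p)) sequentially"
    using v1 eventually_gt_at_top[of 1]
    by eventually_elim (simp add: q_def power_divide)
  ultimately show "(\<lambda>n. real n / (W (e n) * ln (real n) ^ p)) \<longlonglongrightarrow> K"
    unfolding v_def using Lim_transform_eventually by fastforce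
qed

text \<open>The Stolz-Cesaro theorem in its 0/0 form: \<open>b n\<close> is the tail sum of its own
  decrements, and termwise closeness to L times the decrements passes to the tails.\<close>

lemma tail_sum_asymp:
  fixes x b :: "nat \<Rightarrow> real"
  assumes lim: "(\<lambda>n. x n / (b n - b (Suc n))) \<longlonglongrightarrow> L"
    and pos: "eventually (\<lambda>n. 0 < b n - b (Suc n)) sequentially" and b0: "b \<longlonglongrightarrow> 0"
  shows "summable x" and "(\<lambda>n. (\<Sum>j. x (j + n)) / b n) \<longlonglongrightarrow> L"
proof -
  define y where "y n = b n - b (Suc n)" for n
  have y_sums: "(\<lambda>j. y (j + n)) sums b n" for n
  proof -
    have "(\<lambda>j. b (j + n)) \<longlonglongrightarrow> 0" using b0 by (rule LIMSEQ_ignore_initial_segment)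
    from telescope_sums'[OF this] show ?thesis by (simp add: y_def)
  qed
  have close: "eventually (\<lambda>n. \<bar>x n - L * y n\<bar> \<le> \<epsilon> * y n) sequentially" if "0 < \<epsilon>" for \<epsilon>
    using tendstoD[OF lim that] pos
  proof eventually_elim
    case (elim n)
    have "\<bar>x n - L * y n\<bar> = \<bar>x n / y n - L\<bar> * y n"
      using elim by (subst abs_mult_pos) (auto simp: y_def left_diff_distrib)
    thus ?case using elim by (simp add: y_def dist_real_def)
  qed
  show sx: "summable x"
  proof (rule summable_comparison_test_ev)
    show "summable (\<lambda>n. (1 + \<bar>L\<bar>) * y n)"
      using y_sums[of 0] by (intro summable_mult) (auto simp: sums_iff)
    show "eventually (\<lambda>n. norm (x n) \<le> (1 + \<bar>L\<bar>) * y n) sequentially"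
      using close[of 1, simplified] pos
    proof eventually_elim
      case (elim n)
      have "\<bar>L * y n\<bar> = \<bar>L\<bar> * y n" using elim by (simp add: abs_mult y_def)
      thus ?case using elim by (simp add: ring_distribs)
    qed
  qed
  have b_pos: "eventually (\<lambda>n. 0 < b n) sequentially"
  proof -
    obtain n0 where n0: "\<And>n. n0 \<le> n \<Longrightarrow> 0 < y n" using pos by (auto simp: eventually_sequentially y_def)
    have "0 < b n" if "n0 \<le> n" for n
      using y_sums[of n] suminf_pos[of "\<lambda>j. y (j + n)"] n0 that by (auto simp: sums_iff)
    thus ?thesis by (auto simp: eventually_sequentially)
  qed
  show "(\<lambda>n. (\<Sum>j. x (j + n)) / b n) \<longlonglongrightarrow> L"
  proof (rule tendstoI)
    fix e :: real assume e: "0 < e"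
    obtain n0 where n0: "\<And>n. n0 \<le> n \<Longrightarrow> \<bar>x n - L * y n\<bar> \<le> e / 2 * y n"
      using close[of "e/2"] e by (auto simp: eventually_sequentially)
    show "eventually (\<lambda>n. dist ((\<Sum>j. x (j + n)) / b n) L < e) sequentially"
      using b_pos eventually_ge_at_top[of n0]
    proof eventually_elim
      case (elim n)
      have sxn: "summable (\<lambda>j. x (j + n))" using sx by (simp add: summable_iff_shift)
      have syn: "summable (\<lambda>j. y (j + n))" "(\<Sum>j. y (j + n)) = b n" using y_sums[of n] by (auto simp: sums_iff)
      have sd: "summable (\<lambda>j. x (j + n) - L * y (j + n))" using sxn syn by (intro summable_diff summable_mult)
      have "(\<Sum>j. x (j + n)) - L * b n = (\<Sum>j. x (j + n) - L * y (j + n))"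
        using sxn syn by (simp add: suminf_diff[symmetric] suminf_mult summable_mult)
      also have "\<bar>\<dots>\<bar> \<le> (\<Sum>j. e / 2 * y (j + n))"
      proof -
        have bd: "\<bar>x (j + n) - L * y (j + n)\<bar> \<le> e / 2 * y (j + n)" for j using n0[of "j + n"] elim by simp
        have se: "summable (\<lambda>j. e / 2 * y (j + n))" using syn by (intro summable_mult)
        have sa: "summable (\<lambda>j. \<bar>x (j + n) - L * y (j + n)\<bar>)"
          using bd by (intro summable_comparison_test'[OF se, of 0]) auto
        show ?thesis using summable_rabs[OF sa] suminf_le[OF bd sa se] by linarith
      qed
      also have "\<dots> = e / 2 * b n" using suminf_mult[OF syn(1), of "e / 2"] syn(2) by simp
      finally have "\<bar>(\<Sum>j. x (j + n)) - L * b n\<bar> / b n \<le> e / 2"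
        using elim by (simp add: field_simps)
      moreover have "\<bar>(\<Sum>j. x (j + n)) - L * b n\<bar> / b n = \<bar>((\<Sum>j. x (j + n)) - L * b n) / b n\<bar>"
        using elim by (simp add: abs_divide)
      moreover have "((\<Sum>j. x (j + n)) - L * b n) / b n = (\<Sum>j. x (j + n)) / b n - L"
        using elim by (simp add: diff_divide_distrib)
      ultimately show ?case using e by (simp add: dist_real_def)
    qed
  qed
qed

text \<open>The decrement of \<open>b\<close> is to leading order \<sigma> - 1 times n^(-\<sigma>)
  (ln n)^a, which produces the factor 1 / (\<sigma> - 1). The tail starts at n - 1 because rank
  below n leaves room for n - 1 frequencies; the shift is absorbed by b (n-1) / b n -> 1.\<close>

lemma power_log_tail_sum_asymp:
  fixes x :: "nat \<Rightarrow> real"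
  assumes \<sigma>: "1 < \<sigma>" and a: "0 \<le> a"
    and x: "(\<lambda>n. x n / (real n powr (-\<sigma>) * ln (real n) powr a)) \<longlonglongrightarrow> L"
  shows "summable x"
    and "(\<lambda>n. (\<Sum>j. x (j + (n - 1))) / (real n powr (1 - \<sigma>) * ln (real n) powr a)) \<longlonglongrightarrow> L / (\<sigma> - 1)"
proof -
  define b where "b n = real n powr (1 - \<sigma>) * ln (real n) powr a" for n
  have b_diff: "(\<lambda>n. (b n - b (Suc n)) / (real n powr (-\<sigma>) * ln (real n) powr a)) \<longlonglongrightarrow> \<sigma> - 1"
    unfolding b_def using \<sigma> a by real_asymp
  have "(\<lambda>n. x n / (real n powr (-\<sigma>) * ln (real n) powr a) / ((b n - b (Suc n)) / (real n powr (-\<sigma>) * ln (real n) powr a)))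
      \<longlonglongrightarrow> L / (\<sigma> - 1)"
    using \<sigma> by (intro tendsto_divide x b_diff) auto
  moreover have "eventually (\<lambda>n. x n / (real n powr (-\<sigma>) * ln (real n) powr a) / ((b n - b (Suc n)) / (real n powr (-\<sigma>) * ln (real n) powr a))
      = x n / (b n - b (Suc n))) sequentially"
    using eventually_gt_at_top[of 1] by eventually_elim simp
  ultimately have 1: "(\<lambda>n. x n / (b n - b (Suc n))) \<longlonglongrightarrow> L / (\<sigma> - 1)"
    by (rule Lim_transform_eventually)
  have 2: "eventually (\<lambda>n. 0 < b n - b (Suc n)) sequentially"
  proof -
    have "0 < \<sigma> - 1" using \<sigma> by simp
    from order_tendstoD(1)[OF b_diff this] show ?thesis using eventually_gt_at_top[of 1]
    by eventually_elim (auto simp: zero_less_divide_iff mult_less_0_iff)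
  qed
  have 3: "b \<longlonglongrightarrow> 0" unfolding b_def using \<sigma> a by real_asymp
  show "summable x" by (rule tail_sum_asymp(1)[OF 1 2 3])
  have 4: "filterlim (\<lambda>n::nat. n - 1) sequentially sequentially" by (rule filterlim_minus_const_nat_at_top)
  have "(\<lambda>n. (\<Sum>j. x (j + (n - 1))) / b (n - 1)) \<longlonglongrightarrow> L / (\<sigma> - 1)"
    using filterlim_compose[OF tail_sum_asymp(2)[OF 1 2 3] 4] .
  moreover have "(\<lambda>n. b (n - 1) / b n) \<longlonglongrightarrow> 1"
  proof -
    have "((\<lambda>x::real. ((x - 1) powr (1 - \<sigma>) * ln (x - 1) powr a) / (x powr (1 - \<sigma>) * ln x powr a)) \<longlongrightarrow> 1) at_top"
      using \<sigma> a by real_asymp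
    from filterlim_compose[OF this filterlim_real_sequentially]
    have "(\<lambda>n. ((real n - 1) powr (1 - \<sigma>) * ln (real n - 1) powr a) / (real n powr (1 - \<sigma>) * ln (real n) powr a)) \<longlonglongrightarrow> 1" .
    moreover have "eventually (\<lambda>n. ((real n - 1) powr (1 - \<sigma>) * ln (real n - 1) powr a) / (real n powr (1 - \<sigma>) * ln (real n) powr a)
        = b (n - 1) / b n) sequentially"
      using eventually_gt_at_top[of 1] by eventually_elim (simp add: b_def of_nat_diff)
    ultimately show ?thesis by (rule Lim_transform_eventually)
  qed
  ultimately have "(\<lambda>n. (\<Sum>j. x (j + (n - 1))) / b (n - 1) * (b (n - 1) / b n)) \<longlonglongrightarrow> L / (\<sigma> - 1) * 1"
    by (rule tendsto_mult)
  moreover have "eventually (\<lambda>n. (\<Sum>j. x (j + (n - 1))) / b (n - 1) * (b (n - 1) / b n) = (\<Sum>j. x (j + (n - 1))) / b n) sequentially"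
    using eventually_gt_at_top[of 2] by eventually_elim (simp add: b_def of_nat_diff)
  ultimately show "(\<lambda>n. (\<Sum>j. x (j + (n - 1))) / (real n powr (1 - \<sigma>) * ln (real n) powr a)) \<longlonglongrightarrow> L / (\<sigma> - 1)"
    unfolding b_def using Lim_transform_eventually by fastforce
qed

section \<open>Distance of unit vectors to a low-dimensional span\<close>

text \<open>The Hermitian inner product of complex vectors indexed by \<open>F\<close>, kept on
  plain functions because \<open>F\<close> runs through finite sets of varying size.\<close>

definition cip :: "'i set \<Rightarrow> ('i \<Rightarrow> complex) \<Rightarrow> ('i \<Rightarrow> complex) \<Rightarrow> complex" where
  "cip F u v = (\<Sum>j\<in>F. u j * cnj (v j))"

lemma cip_self: "cip F u u = of_real (\<Sum>j\<in>F. (cmod (u j))\<^sup>2)"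
  unfolding cip_def of_real_sum by (intro sum.cong refl) (rule complex_norm_square[symmetric])

lemma cip_cnj: "cip F v u = cnj (cip F u v)"
  by (simp add: cip_def mult.commute)

lemma cip_diff_left: "cip F (\<lambda>j. u j - v j) z = cip F u z - cip F v z"
  by (simp add: cip_def left_diff_distrib sum_subtractf)

lemma cip_scale_left: "cip F (\<lambda>j. c * u j) z = c * cip F u z"
  by (simp add: cip_def sum_distrib_left mult.assoc)

lemma cip_sum_left: "cip F (\<lambda>j. \<Sum>a\<in>A. b a * q a j) z = (\<Sum>a\<in>A. b a * cip F (q a) z)"
  unfolding cip_def by (simp add: sum_distrib_left sum_distrib_right mult.assoc) (rule sum.swap)

lemma cip_diff_right: "cip F z (\<lambda>j. u j - v j) = cip F z u - cip F z v"
  by (simp add: cip_def right_diff_distrib sum_subtractf)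

definition orthonormal_fam :: "'i set \<Rightarrow> nat \<Rightarrow> (nat \<Rightarrow> 'i \<Rightarrow> complex) \<Rightarrow> bool" where
  "orthonormal_fam F m q \<longleftrightarrow> (\<forall>a<m. \<forall>b<m. cip F (q a) (q b) = (if a = b then 1 else 0))"

text \<open>Pythagoras with the optimal coefficients \<open>cip F v (q a)\<close>. Arbitrary
  \<open>b\<close> yields the lower bound for the distance to the span; the optimal \<open>b\<close>
  shows that this bound is itself nonnegative.\<close>

lemma orthonormal_fam_distance:
  assumes q: "orthonormal_fam F m q"
  shows "(\<Sum>j\<in>F. (cmod (v j - (\<Sum>a<m. b a * q a j)))\<^sup>2)
    = (\<Sum>j\<in>F. (cmod (v j))\<^sup>2) - (\<Sum>a<m. (cmod (cip F v (q a)))\<^sup>2) + (\<Sum>a<m. (cmod (b a - cip F v (q a)))\<^sup>2)"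
proof -
  define S where "S j = (\<Sum>a<m. b a * q a j)" for j
  have Sq: "cip F S (q a) = b a" if "a < m" for a
  proof -
    have "cip F S (q a) = (\<Sum>c<m. b c * cip F (q c) (q a))"
      unfolding S_def[abs_def] by (rule cip_sum_left)
    also have "\<dots> = (\<Sum>c<m. if c = a then b a else 0)"
      using q that by (intro sum.cong) (auto simp: orthonormal_fam_def)
    finally show ?thesis using that by simp
  qed
  have Sz: "cip F S z = (\<Sum>a<m. b a * cip F (q a) z)" for z
    unfolding S_def[abs_def] by (rule cip_sum_left)
  have Sv: "cip F S v = (\<Sum>a<m. b a * cnj (cip F v (q a)))"
    unfolding Sz by (simp add: cip_cnj[of F v])
  have SS: "cip F S S = (\<Sum>a<m. b a * cnj (b a))"
  proof -
    have "cip F (q a) S = cnj (b a)" if "a < m" for a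
      using Sq[OF that] by (subst cip_cnj) simp
    thus ?thesis unfolding Sz by simp
  qed
  have "complex_of_real (\<Sum>j\<in>F. (cmod (v j - S j))\<^sup>2) = cip F (\<lambda>j. v j - S j) (\<lambda>j. v j - S j)"
    by (rule cip_self[symmetric])
  also have "\<dots> = cip F v v - cnj (cip F S v) - cip F S v + cip F S S"
    by (simp add: cip_diff_left cip_diff_right cip_cnj[of F v S])
  also have "\<dots> = cip F v v - (\<Sum>a<m. cip F v (q a) * cnj (cip F v (q a)))
      + (\<Sum>a<m. (b a - cip F v (q a)) * cnj (b a - cip F v (q a)))"
    unfolding SS Sv by (simp add: algebra_simps sum.distrib sum_subtractf)
  also have "\<dots> = complex_of_real ((\<Sum>j\<in>F. (cmod (v j))\<^sup>2) - (\<Sum>a<m. (cmod (cip F v (q a)))\<^sup>2)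
      + (\<Sum>a<m. (cmod (b a - cip F v (q a)))\<^sup>2))"
    by (simp only: cip_self of_real_add of_real_diff of_real_sum complex_norm_square)
  finally show ?thesis unfolding S_def of_real_eq_iff .
qed

text \<open>Gram-Schmidt: a vector whose residual vanishes on \<open>F\<close> is dropped, so
  linearly dependent families are allowed and only m' <= m survives.\<close>

lemma ex_orthonormal_fam:
  assumes "finite F"
  shows "\<exists>m'\<le>m. \<exists>q. orthonormal_fam F m' q \<and> (\<forall>i<m. \<exists>b. \<forall>j\<in>F. G i j = (\<Sum>a<m'. b a * q a j))"
proof (induction m)
  case 0
  show ?case by (intro exI[of _ 0]) (simp add: orthonormal_fam_def)
next
  case (Suc m)
  then obtain m' q where q: "m' \<le> m" "orthonormal_fam F m' q"
    "\<And>i. i < m \<Longrightarrow> \<exists>b. \<forall>j\<in>F. G i j = (\<Sum>a<m'. b a * q a j)" by blast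
  define b0 where "b0 a = cip F (G m) (q a)" for a
  define R where "R j = G m j - (\<Sum>a<m'. b0 a * q a j)" for j
  define N where "N = (\<Sum>j\<in>F. (cmod (R j))\<^sup>2)"
  show ?case
  proof (cases "N = 0")
    case True
    hence "R j = 0" if "j \<in> F" for j
      using that assms unfolding N_def by (subst (asm) sum_nonneg_eq_0_iff) auto
    hence "\<forall>j\<in>F. G m j = (\<Sum>a<m'. b0 a * q a j)" by (simp add: R_def)
    hence "\<forall>i<Suc m. \<exists>b. \<forall>j\<in>F. G i j = (\<Sum>a<m'. b a * q a j)"
      using q(3) less_antisym by blast
    thus ?thesis using q by (intro exI[of _ m']) auto
  next
    case False
    hence N: "0 < N" unfolding N_def by (simp add: order.not_eq_order_implies_strict sum_nonneg)
    define q' where "q' a = (if a = m' then (\<lambda>j. of_real (1 / sqrt N) * R j) else q a)" for a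
    have Rq: "cip F R (q a) = 0" if a: "a < m'" for a
    proof -
      have "cip F (\<lambda>j. \<Sum>c<m'. b0 c * q c j) (q a) = (\<Sum>c<m'. b0 c * cip F (q c) (q a))"
        by (rule cip_sum_left)
      also have "\<dots> = (\<Sum>c<m'. if c = a then b0 a else 0)"
        using q(2) a by (intro sum.cong) (auto simp: orthonormal_fam_def)
      finally have "cip F (\<lambda>j. \<Sum>c<m'. b0 c * q c j) (q a) = b0 a" using a by simp
      thus ?thesis unfolding R_def[abs_def] cip_diff_left by (simp add: b0_def)
    qed
    have RR: "cip F R R = of_real N" unfolding N_def by (rule cip_self)
    have new: "cip F (q' m') z = of_real (1 / sqrt N) * cip F R z" for z
      by (simp add: q'_def cip_scale_left del: of_real_divide)
    have "cip F (q' m') (q' m') = of_real (1 / sqrt N) * cnj (of_real (1 / sqrt N) * cip F R R)"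
      unfolding new by (subst cip_cnj[of F R], subst new) (simp add: RR)
    also have "\<dots> = of_real (1 / sqrt N * (1 / sqrt N * N))"
      unfolding RR by (simp only: complex_cnj_mult complex_cnj_complex_of_real of_real_mult)
    also have "1 / sqrt N * (1 / sqrt N * N) = 1" using N by (simp add: real_div_sqrt)
    finally have diag: "cip F (q' m') (q' m') = 1" by simp
    have off: "cip F (q' m') (q a) = 0" "cip F (q a) (q' m') = 0" if "a < m'" for a
    proof -
      show "cip F (q' m') (q a) = 0" unfolding new using Rq[OF that] by simp
      thus "cip F (q a) (q' m') = 0" by (subst cip_cnj) simp
    qed
    have orth: "orthonormal_fam F (Suc m') q'"
      unfolding orthonormal_fam_def
    proof (intro allI impI)
      fix a b assume "a < Suc m'" "b < Suc m'"
      thus "cip F (q' a) (q' b) = (if a = b then 1 else 0)"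
        using diag off q(2) unfolding less_Suc_eq orthonormal_fam_def by (auto simp: q'_def)
    qed
    have "complex_of_real (sqrt N) * of_real (1 / sqrt N) = 1"
      using N unfolding of_real_mult[symmetric] by simp
    hence Rrep: "R j = of_real (sqrt N) * q' m' j" for j
      by (simp add: q'_def mult.assoc[symmetric] del: of_real_divide)
    have "\<exists>b. \<forall>j\<in>F. G i j = (\<Sum>a<Suc m'. b a * q' a j)" if i: "i < Suc m" for i
    proof (cases "i = m")
      case True
      define b where "b = b0(m' := of_real (sqrt N))"
      have "(\<Sum>a<m'. b a * q' a j) = (\<Sum>a<m'. b0 a * q a j)" for j
        by (intro sum.cong) (auto simp: b_def q'_def)
      hence "G m j = (\<Sum>a<Suc m'. b a * q' a j)" for j
        using Rrep[of j] by (simp add: b_def R_def diff_eq_eq add.commute)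
      thus ?thesis using True by blast
    next
      case False
      then obtain b where b: "\<forall>j\<in>F. G i j = (\<Sum>a<m'. b a * q a j)" using q(3)[of i] i by auto
      have "(\<Sum>a<m'. (b(m' := 0)) a * q' a j) = (\<Sum>a<m'. b a * q a j)" for j
        by (intro sum.cong) (auto simp: q'_def)
      hence "\<forall>j\<in>F. G i j = (\<Sum>a<Suc m'. (b(m' := 0)) a * q' a j)" using b by simp
      thus ?thesis by blast
    qed
    thus ?thesis using q(1) orth by (intro exI[of _ "Suc m'"]) auto
  qed
qed

text \<open>Here \<open>p k\<close> is the \<open>k\<close>-th diagonal entry of the orthogonal projection onto the span of the
  \<open>G i\<close>, whose trace is its rank.\<close>
lemma finite_rank_distance:
  fixes G :: "nat \<Rightarrow> 'i \<Rightarrow> complex"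
  assumes F: "finite F"
  obtains p :: "'i \<Rightarrow> real" where "\<And>k. k \<in> F \<Longrightarrow> 0 \<le> p k \<and> p k \<le> 1" "(\<Sum>k\<in>F. p k) \<le> real m"
    "\<And>k a. k \<in> F \<Longrightarrow>
       1 - p k \<le> (\<Sum>j\<in>F. (cmod ((if j = k then 1 else 0) - (\<Sum>i<m. a i * G i j)))\<^sup>2)"
proof -
  obtain m' q where q: "m' \<le> m" "orthonormal_fam F m' q"
    "\<And>i. i < m \<Longrightarrow> \<exists>b. \<forall>j\<in>F. G i j = (\<Sum>a<m'. b a * q a j)"
    using ex_orthonormal_fam[OF F, of m G] by blast
  then obtain B where B: "\<And>i j. i < m \<Longrightarrow> j \<in> F \<Longrightarrow> G i j = (\<Sum>a<m'. B i a * q a j)" by metis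
  define p where "p k = (\<Sum>a<m'. (cmod (q a k))\<^sup>2)" for k
  define \<delta> where "\<delta> k j = (if j = k then 1 else 0 :: complex)" for k j :: 'i
  have ip: "cip F (\<delta> k) (q a) = cnj (q a k)" if "k \<in> F" for k a
  proof -
    have "cip F (\<delta> k) (q a) = (\<Sum>j\<in>F. if j = k then cnj (q a k) else 0)"
      unfolding cip_def \<delta>_def by (intro sum.cong) auto
    thus ?thesis using that F by simp
  qed
  have nrm: "(\<Sum>j\<in>F. (cmod (\<delta> k j))\<^sup>2) = 1" if "k \<in> F" for k
  proof -
    have "(\<Sum>j\<in>F. (cmod (\<delta> k j))\<^sup>2) = (\<Sum>j\<in>F. if j = k then 1 else 0)"
      unfolding \<delta>_def by (intro sum.cong) auto
    thus ?thesis using that F by simp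
  qed
  have dist: "1 - p k \<le> (\<Sum>j\<in>F. (cmod (\<delta> k j - (\<Sum>a<m'. b a * q a j)))\<^sup>2)" if k: "k \<in> F" for k b
  proof -
    have "(\<Sum>a<m'. (cmod (cip F (\<delta> k) (q a)))\<^sup>2) = p k"
      unfolding ip[OF k] p_def by simp
    thus ?thesis unfolding orthonormal_fam_distance[OF q(2)] nrm[OF k]
      by (simp add: sum_nonneg)
  qed
  show thesis
  proof (rule that)
    fix k assume k: "k \<in> F"
    have "0 \<le> (\<Sum>j\<in>F. (cmod (\<delta> k j - (\<Sum>a<m'. cip F (\<delta> k) (q a) * q a j)))\<^sup>2)" by (intro sum_nonneg) auto
    also have "\<dots> = 1 - p k"
      unfolding orthonormal_fam_distance[OF q(2)] nrm[OF k] by (simp add: ip[OF k] p_def)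
    finally show "0 \<le> p k \<and> p k \<le> 1" by (simp add: p_def sum_nonneg)
  next
    have "(\<Sum>k\<in>F. p k) = (\<Sum>a<m'. \<Sum>k\<in>F. (cmod (q a k))\<^sup>2)"
      unfolding p_def by (rule sum.swap)
    also have "\<dots> = (\<Sum>a<m'. 1)"
    proof (intro sum.cong refl)
      fix a assume "a \<in> {..<m'}"
      hence "cip F (q a) (q a) = 1" using q(2) by (simp add: orthonormal_fam_def)
      thus "(\<Sum>k\<in>F. (cmod (q a k))\<^sup>2) = 1" unfolding cip_self by (metis of_real_eq_1_iff)
    qed
    finally show "(\<Sum>k\<in>F. p k) \<le> real m" using q(1) by simp
  next
    fix k a assume k: "k \<in> F"
    \<comment> \<open>Any combination of the \<open>G i\<close> is rewritten in the orthonormal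
      family, so that one and the same \<open>p\<close> works for all coefficients.\<close>
    have "(\<Sum>i<m. a i * G i j) = (\<Sum>c<m'. (\<Sum>i<m. a i * B i c) * q c j)" if "j \<in> F" for j
      using B that by (simp add: sum_distrib_left sum_distrib_right mult.assoc) (rule sum.swap)
    hence "(\<Sum>j\<in>F. (cmod (\<delta> k j - (\<Sum>i<m. a i * G i j)))\<^sup>2)
        = (\<Sum>j\<in>F. (cmod (\<delta> k j - (\<Sum>c<m'. (\<Sum>i<m. a i * B i c) * q c j)))\<^sup>2)"
      by (intro sum.cong) auto
    thus "1 - p k \<le> (\<Sum>j\<in>F. (cmod ((if j = k then 1 else 0) - (\<Sum>i<m. a i * G i j)))\<^sup>2)"
      using dist[OF k] by (simp add: \<delta>_def)
  qed
qed

text \<open>Duality between weighted l2 norms: at the extremal coefficients the hypothesis reads T^2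
  <= B^2 T for the sum \<open>T\<close> to be bounded. Coefficients in \<open>Q\<close> suffice by
  density, since both sides are continuous in finitely many variables; \<open>Q\<close> will be
  countable.\<close>

lemma dense_coefficients_bound:
  fixes u :: "'i \<Rightarrow> complex" and W :: "'i \<Rightarrow> real"
  assumes F: "finite F" and dense: "\<And>X. open X \<Longrightarrow> X \<noteq> {} \<Longrightarrow> \<exists>d\<in>Q. d \<in> X"
    and W: "\<And>k. 0 < W k"
    and bound: "\<And>c. c \<in> F \<rightarrow>\<^sub>E Q \<Longrightarrow> (cmod (\<Sum>k\<in>F. c k * u k))\<^sup>2 \<le> B\<^sup>2 * (\<Sum>k\<in>F. W k * (cmod (c k))\<^sup>2)"
  shows "(\<Sum>k\<in>F. (cmod (u k))\<^sup>2 / W k) \<le> B\<^sup>2"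
proof -
  \<comment> \<open>The equality case of the Cauchy-Schwarz inequality.\<close>
  define z where "z k = cnj (u k) / W k" for k
  define T where "T = (\<Sum>k\<in>F. (cmod (u k))\<^sup>2 / W k)"
  have "\<exists>d\<in>Q. d \<in> ball (z k) (inverse (real (Suc n)))" for k n by (intro dense) auto
  hence "\<forall>n k. \<exists>d. d \<in> Q \<and> dist (z k) d < inverse (real (Suc n))" unfolding mem_ball by blast
  then obtain d where d: "\<And>k n. d n k \<in> Q" "\<And>k n. dist (z k) (d n k) < inverse (real (Suc n))"
    by metis
  have d_lim: "(\<lambda>n. d n k) \<longlonglongrightarrow> z k" for k
  proof (rule LIMSEQ_I)
    fix \<epsilon> :: real assume "0 < \<epsilon>"
    then obtain N where N: "inverse (real (Suc N)) < \<epsilon>" using reals_Archimedean by blast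
    have "norm (d n k - z k) < \<epsilon>" if "N \<le> n" for n
    proof -
      have "inverse (real (Suc n)) \<le> inverse (real (Suc N))" using that by (intro le_imp_inverse_le) auto
      thus ?thesis using d(2)[of k n] N unfolding dist_norm norm_minus_commute[of "z k"] by linarith
    qed
    thus "\<exists>N. \<forall>n\<ge>N. norm (d n k - z k) < \<epsilon>" by blast
  qed
  have le: "(cmod (\<Sum>k\<in>F. d n k * u k))\<^sup>2 \<le> B\<^sup>2 * (\<Sum>k\<in>F. W k * (cmod (d n k))\<^sup>2)" for n
  proof -
    have "restrict (d n) F \<in> F \<rightarrow>\<^sub>E Q" using d(1) by auto
    from bound[OF this] show ?thesis by (simp cong: sum.cong)
  qed
  have "(cmod (\<Sum>k\<in>F. z k * u k))\<^sup>2 \<le> B\<^sup>2 * (\<Sum>k\<in>F. W k * (cmod (z k))\<^sup>2)"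
  proof (rule LIMSEQ_le)
    show "(\<lambda>n. (cmod (\<Sum>k\<in>F. d n k * u k))\<^sup>2) \<longlonglongrightarrow> (cmod (\<Sum>k\<in>F. z k * u k))\<^sup>2"
      by (intro tendsto_intros d_lim)
    show "(\<lambda>n. B\<^sup>2 * (\<Sum>k\<in>F. W k * (cmod (d n k))\<^sup>2)) \<longlonglongrightarrow> B\<^sup>2 * (\<Sum>k\<in>F. W k * (cmod (z k))\<^sup>2)"
      by (intro tendsto_intros d_lim)
  qed (use le in blast)
  moreover have "(\<Sum>k\<in>F. z k * u k) = of_real T"
    unfolding T_def of_real_sum of_real_divide complex_norm_square
    by (intro sum.cong) (simp_all add: z_def mult.commute)
  moreover have "W k * (cmod (z k))\<^sup>2 = (cmod (u k))\<^sup>2 / W k" for k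
    using W[of k] by (simp add: z_def norm_divide power_divide power2_eq_square)
  moreover have T: "0 \<le> T" unfolding T_def using W by (intro sum_nonneg) (simp add: less_imp_le)
  ultimately have "T\<^sup>2 \<le> B\<^sup>2 * T" by (simp only: T_def[symmetric] norm_of_real power2_abs)
  hence "T * T \<le> B\<^sup>2 * T" by (simp add: power2_eq_square)
  hence "T \<le> B\<^sup>2" using T by (cases "T = 0") auto
  thus ?thesis by (simp add: T_def)
qed

text \<open>The bathtub principle: \<open>p\<close> removes mass at most 1 per point and at most
  \<open>m\<close> in total, so it removes no more than \<open>L\<close>, where \<open>v\<close> is
  largest. The threshold \<open>t\<close> compares what is left of \<open>L\<close> with what is
  taken outside it.\<close>

lemma bathtub_sum:
  fixes v p :: "'i \<Rightarrow> real"
  assumes F: "finite F" and L: "L \<subseteq> F" "real m \<le> card L"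
    and t: "\<And>k. k \<in> L \<Longrightarrow> t \<le> v k" "\<And>k. k \<in> F - L \<Longrightarrow> v k \<le> t" "0 \<le> t"
    and p: "\<And>k. k \<in> F \<Longrightarrow> 0 \<le> p k \<and> p k \<le> 1" "sum p F \<le> real m"
  shows "sum v (F - L) \<le> (\<Sum>k\<in>F. v k * (1 - p k))"
proof -
  have fL: "finite L" using F L finite_subset by blast
  have split: "sum h F = sum h L + sum h (F - L)" for h :: "'i \<Rightarrow> real"
    using F L(1) by (metis sum.subset_diff add.commute)
  have "t * (real (card L) - sum p L) = (\<Sum>k\<in>L. t * (1 - p k))"
    by (simp add: sum_distrib_left[symmetric] sum_subtractf)
  also have "\<dots> \<le> (\<Sum>k\<in>L. v k * (1 - p k))"
    using t p L by (intro sum_mono mult_right_mono) auto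
  finally have 1: "t * (real (card L) - sum p L) \<le> (\<Sum>k\<in>L. v k * (1 - p k))" .
  have 2: "(\<Sum>k\<in>F - L. v k * p k) \<le> t * sum p (F - L)"
    unfolding sum_distrib_left using t p by (intro sum_mono mult_right_mono) auto
  have "sum p L + sum p (F - L) \<le> real (card L)" using p(2) L(2) split[of p] by simp
  hence "t * sum p (F - L) \<le> t * (real (card L) - sum p L)" using t(3) by (intro mult_left_mono) auto
  hence "(\<Sum>k\<in>F - L. v k * p k) \<le> (\<Sum>k\<in>L. v k * (1 - p k))" using 1 2 by linarith
  moreover have "(\<Sum>k\<in>F. v k * (1 - p k)) = (\<Sum>k\<in>L. v k * (1 - p k)) + (sum v (F - L) - (\<Sum>k\<in>F - L. v k * p k))"
    unfolding split by (simp add: right_diff_distrib sum_subtractf)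
  ultimately show ?thesis by linarith
qed

section \<open>Fourier series on the torus\<close>

abbreviation torus_measure :: "(real^'d) measure" where
  "torus_measure \<equiv> lebesgue_on torus_cube"

definition chr :: "int^'d \<Rightarrow> real^'d \<Rightarrow> complex" where
  "chr k x = cis (\<Sum>i\<in>UNIV. real_of_int (k $ i) * x $ i)"

lemma chr_add: "chr (k + l) x = chr k x * chr l x"
  by (simp add: chr_def cis_mult ring_distribs sum.distrib)

lemma chr_0 [simp]: "chr 0 x = 1"
  by (simp add: chr_def)

lemma chr_uminus: "chr (-k) x = cnj (chr k x)"
  by (simp add: chr_def cis_cnj sum_negf)

lemma norm_chr [simp]: "cmod (chr k x) = 1"
  by (simp add: chr_def)

lemma continuous_on_chr [continuous_intros]: "continuous_on S (chr k)"
  unfolding chr_def cis_conv_exp by (intro continuous_intros)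

lemma torus_cube_Basis: "torus_cube = {x :: real^'d. \<forall>b\<in>Basis. x \<bullet> b \<in> {0..<2 * pi}}"
  by (auto simp: torus_cube_def Basis_vec_def inner_axis)

lemma torus_cube_borel [measurable]: "(torus_cube :: (real^'d) set) \<in> sets borel"
proof -
  have "(torus_cube :: (real^'d) set) = (\<Inter>i. {x :: real^'d. 0 \<le> x $ i} \<inter> {x. x $ i < 2 * pi})"
    by (auto simp: torus_cube_def)
  moreover have "closed {x :: real^'d. 0 \<le> x $ i}" for i
    by (intro closed_Collect_le continuous_intros)
  moreover have "open {x :: real^'d. x $ i < 2 * pi}" for i
    by (intro open_Collect_less continuous_intros)
  ultimately show ?thesis
    using sets.finite_INT[of UNIV "\<lambda>i. {x :: real^'d. 0 \<le> x $ i} \<inter> {x. x $ i < 2 * pi}" borel]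
    by (auto simp: borel_closed borel_open sets.Int)
qed

lemma borel_measurable_torusI: "f \<in> borel_measurable borel \<Longrightarrow> f \<in> borel_measurable torus_measure"
  by (intro measurable_restrict_space1 measurable_completion) auto

text \<open>The torus carries completed Lebesgue measure; moving Borel integrands to
  \<open>lborel\<close> gives access to product measures.\<close>

lemma integral_torus_borel:
  fixes f :: "real^'d \<Rightarrow> 'b::{banach, second_countable_topology}"
  assumes "f \<in> borel_measurable borel"
  shows "integral\<^sup>L torus_measure f = (\<integral>x. indicator torus_cube x *\<^sub>R f x \<partial>lborel)"
  using assms by (subst integral_restrict_space) (auto simp: integral_completion)

lemma integral_cis_period:
  "(\<integral>t. indicator {0..<2 * pi} t *\<^sub>R cis (of_int m * t) \<partial>lborel) = (if m = 0 then 2 * pi else 0)"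
  "integrable lborel (\<lambda>t. indicator {0..<2 * pi} t *\<^sub>R cis (of_int m * t))"
proof -
  define F where "F t = (if m = 0 then of_real t else cis (of_int m * t) / (\<i> * of_int m))" for t :: real
  have "has_bochner_integral lborel (\<lambda>t. indicator {0..2 * pi} t *\<^sub>R cis (of_int m * t)) (F (2 * pi) - F 0)"
  proof (rule has_bochner_integral_FTC_Icc)
    fix t :: real
    define G where "G z = (if m = 0 then z else exp (\<i> * of_int m * z) / (\<i> * of_int m))" for z :: complex
    have "(G has_field_derivative exp (\<i> * of_int m * of_real t)) (at (of_real t))"
      unfolding G_def by (cases "m = 0") (auto intro!: derivative_eq_intros)
    from has_vector_derivative_real_field[OF this, of "{0..2 * pi}"]
    have "((\<lambda>x. G (of_real x)) has_vector_derivative cis (of_int m * t)) (at t within {0..2 * pi})"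
      by (simp add: cis_conv_exp mult_ac)
    moreover have "(\<lambda>x. G (of_real x)) = F" by (simp add: G_def F_def fun_eq_iff cis_conv_exp mult_ac)
    ultimately show "(F has_vector_derivative cis (of_int m * t)) (at t within {0..2 * pi})" by simp
    show "continuous_on {0..2 * pi} (\<lambda>t. cis (of_int m * t))"
      unfolding cis_conv_exp by (intro continuous_intros)
  qed simp
  moreover have "F (2 * pi) - F 0 = (if m = 0 then 2 * pi else 0)"
  proof (cases "m = 0")
    case False
    have "cis (of_int m * (2 * pi)) = 1" by (metis cis_multiple_2pi Ints_of_int mult.commute)
    thus ?thesis using False by (simp add: F_def)
  qed (simp add: F_def)
  moreover have "AE t in lborel. (indicator {0..2 * pi} t *\<^sub>R cis (of_int m * t)) = (indicator {0..<2 * pi} t *\<^sub>R cis (of_int m * t))"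
    using AE_lborel_singleton[of "2 * pi"] by eventually_elim (auto split: split_indicator)
  ultimately have "has_bochner_integral lborel (\<lambda>t. indicator {0..<2 * pi} t *\<^sub>R cis (of_int m * t)) (if m = 0 then 2 * pi else 0)"
    by (subst has_bochner_integral_cong_AE[symmetric]) (auto simp: cis_conv_exp)
  thus "(\<integral>t. indicator {0..<2 * pi} t *\<^sub>R cis (of_int m * t) \<partial>lborel) = (if m = 0 then 2 * pi else 0)"
    "integrable lborel (\<lambda>t. indicator {0..<2 * pi} t *\<^sub>R cis (of_int m * t))"
    by (auto simp: has_bochner_integral_iff)
qed

lemma integral_chr: "integral\<^sup>L torus_measure (chr (k :: int^'d)) = (if k = 0 then (2 * pi) ^ CARD('d) else 0)"
proof -
  \<comment> \<open>\<open>lborel\<close> is built as a product over \<open>Basis\<close>, so the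
    frequency is turned into a real vector whose inner products with basis vectors replace the
    coordinates of \<open>k\<close>.\<close>
  define \<kappa> :: "real^'d" where "\<kappa> = (\<chi> i. real_of_int (k $ i))"
  define \<phi> where "\<phi> b t = indicator {0..<2 * pi} t *\<^sub>R cis (\<kappa> \<bullet> b * t)" for b :: "real^'d" and t
  have \<kappa>_Basis: "\<exists>i. b = axis i 1 \<and> \<kappa> \<bullet> b = real_of_int (k $ i)" if "b \<in> Basis" for b
    using that by (auto simp: Basis_vec_def \<kappa>_def inner_axis)
  have \<phi>_int: "integrable lborel (\<phi> b)" and \<phi>_val: "integral\<^sup>L lborel (\<phi> b) = (if \<kappa> \<bullet> b = 0 then 2 * pi else 0)"
    if "b \<in> Basis" for b
    using \<kappa>_Basis[OF that] integral_cis_period unfolding \<phi>_def by (auto simp: scaleR_conv_of_real)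
  have eq: "indicator torus_cube x *\<^sub>R chr k x = (\<Prod>b\<in>Basis. \<phi> b (x \<bullet> b))" for x
  proof -
    have "(\<Sum>i\<in>UNIV. real_of_int (k $ i) * x $ i) = \<kappa> \<bullet> x" by (simp add: inner_vec_def \<kappa>_def)
    also have "\<dots> = (\<Sum>b\<in>Basis. \<kappa> \<bullet> b * (x \<bullet> b))" by (rule euclidean_inner)
    finally have "chr k x = (\<Prod>b\<in>Basis. cis (\<kappa> \<bullet> b * (x \<bullet> b)))"
      unfolding chr_def cis_conv_exp by (simp add: sum_distrib_left exp_sum)
    moreover have "indicator torus_cube x = (\<Prod>b\<in>Basis. indicator {0..<2 * pi} (x \<bullet> b) :: real)"
      unfolding torus_cube_Basis by (auto simp: indicator_def prod_zero_iff)
    ultimately show ?thesis by (simp add: \<phi>_def scaleR_conv_of_real prod.distrib)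
  qed
  interpret product_sigma_finite "\<lambda>_ :: real^'d. lborel :: real measure" ..
  have "integral\<^sup>L torus_measure (chr k) = (\<integral>x. (\<Prod>b\<in>Basis. \<phi> b (x \<bullet> b)) \<partial>lborel)"
    unfolding eq[symmetric] by (intro integral_torus_borel borel_measurable_continuous_onI continuous_on_chr)
  \<comment> \<open>By definition \<open>lborel\<close> is the image of a product of one-dimensional
    measures, under which the integral of the product factors.\<close>
  also have "\<dots> = (\<integral>y. (\<Prod>b\<in>Basis. \<phi> b ((\<Sum>b'\<in>Basis. y b' *\<^sub>R b') \<bullet> b)) \<partial>(\<Pi>\<^sub>M b\<in>Basis. lborel))"
    by (subst lborel_def, subst lborel_eq_real[symmetric], subst integral_distr) (auto simp: \<phi>_def cis_conv_exp)
  also have "\<dots> = (\<integral>y. (\<Prod>b\<in>Basis. \<phi> b (y b)) \<partial>(\<Pi>\<^sub>M b\<in>Basis. lborel))"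
    by (intro Bochner_Integration.integral_cong prod.cong refl) simp
  also have "\<dots> = (\<Prod>b\<in>Basis. integral\<^sup>L lborel (\<phi> b))"
    using \<phi>_int by (intro product_integral_prod) auto
  also have "\<dots> = (\<Prod>b\<in>(Basis :: (real^'d) set). complex_of_real (if \<kappa> \<bullet> b = 0 then 2 * pi else 0))"
    using \<phi>_val by (intro prod.cong) auto
  also have "\<dots> = (if k = 0 then (2 * pi) ^ CARD('d) else 0)"
  proof (cases "k = 0")
    case True
    thus ?thesis by (simp add: \<kappa>_def zero_vec_def[symmetric])
  next
    case False
    then obtain i where "k $ i \<noteq> 0" by (auto simp: vec_eq_iff)
    hence "\<kappa> \<bullet> axis i 1 \<noteq> 0" by (simp add: \<kappa>_def inner_axis)
    moreover have "axis i 1 \<in> (Basis :: (real^'d) set)" by simp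
    ultimately have "\<exists>b\<in>(Basis :: (real^'d) set). complex_of_real (if \<kappa> \<bullet> b = 0 then 2 * pi else 0) = 0" by force
    thus ?thesis using False by (subst prod_zero) auto
  qed
  finally show ?thesis .
qed

lemma finite_torus_measure: "finite_measure (torus_measure :: (real^'d) measure)"
proof (intro finite_measure_lebesgue_on bounded_set_imp_lmeasurable)
  have "torus_cube \<subseteq> cbox (0 :: real^'d) (\<chi> i. 2 * pi)"
    by (auto simp: torus_cube_def mem_box_cart less_imp_le)
  thus "bounded (torus_cube :: (real^'d) set)" using bounded_cbox bounded_subset by blast
qed simp

interpretation torus: finite_measure "torus_measure :: (real^'d) measure"
  by (rule finite_torus_measure)

lemma measure_torus: "measure (torus_measure :: (real^'d) measure) torus_cube = (2 * pi) ^ CARD('d)"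
proof -
  have "complex_of_real (measure (torus_measure :: (real^'d) measure) torus_cube) = integral\<^sup>L torus_measure (chr (0 :: int^'d))"
    using lebesgue_integral_const[of torus_measure "1::complex"]
    by (simp add: chr_def[abs_def] scaleR_conv_of_real)
  also have "\<dots> = complex_of_real ((2 * pi) ^ CARD('d))" by (simp add: integral_chr)
  finally show ?thesis by (simp only: of_real_eq_iff)
qed

lemma borel_measurable_chr [measurable]: "chr k \<in> borel_measurable torus_measure"
  by (intro borel_measurable_torusI borel_measurable_continuous_onI continuous_on_chr)

lemma integrable_mult_bounded:
  fixes f T :: "'a \<Rightarrow> complex"
  assumes "integrable M f" "T \<in> borel_measurable M" "\<And>x. cmod (T x) \<le> B"
  shows "integrable M (\<lambda>x. f x * T x)"
proof (rule Bochner_Integration.integrable_bound)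
  show "integrable M (\<lambda>x. B * cmod (f x))" using assms by auto
  show "(\<lambda>x. f x * T x) \<in> borel_measurable M" using assms by measurable
  have "0 \<le> B" using assms(3) norm_ge_zero order.trans by blast
  thus "AE x in M. norm (f x * T x) \<le> norm (B * cmod (f x))"
    using assms(3) by (auto simp: norm_mult abs_mult mult.commute[of B] intro!: mult_left_mono)
qed

lemma integrable_mult_chr:
  "integrable torus_measure f \<Longrightarrow> integrable torus_measure (\<lambda>x. f x * chr k x)"
  by (rule integrable_mult_bounded[where B = 1]) auto

lemma fcoeff_altdef:
  "fcoeff f (k :: int^'d) = complex_of_real (1 / (2 * pi) ^ CARD('d)) * integral\<^sup>L torus_measure (\<lambda>x. f x * chr (-k) x)"
  by (simp add: fcoeff_def chr_def sum_negf)

lemma fcoeff_chr: "fcoeff (chr j) k = (if j = k then 1 else 0)"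
  by (simp add: fcoeff_altdef chr_add[symmetric] integral_chr)

lemma fcoeff_linear:
  assumes "integrable torus_measure f" "integrable torus_measure g"
  shows "fcoeff (\<lambda>x. a * f x + b * g x) k = a * fcoeff f k + b * fcoeff g k"
proof -
  have "(\<lambda>x. (a * f x + b * g x) * chr (-k) x) = (\<lambda>x. a * (f x * chr (-k) x) + b * (g x * chr (-k) x))"
    by (simp add: fun_eq_iff algebra_simps)
  thus ?thesis using integrable_mult_chr[OF assms(1)] integrable_mult_chr[OF assms(2)]
    by (simp add: fcoeff_altdef algebra_simps)
qed

lemma fcoeff_sum:
  assumes "\<And>i. i \<in> I \<Longrightarrow> integrable torus_measure (f i)"
  shows "fcoeff (\<lambda>x. \<Sum>i\<in>I. c i * f i x) k = (\<Sum>i\<in>I. c i * fcoeff (f i) k)"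
proof -
  have "(\<lambda>x. (\<Sum>i\<in>I. c i * f i x) * chr (-k) x) = (\<lambda>x. (\<Sum>i\<in>I. c i * (f i x * chr (-k) x)))"
    by (simp add: fun_eq_iff sum_distrib_right sum_distrib_left mult_ac)
  hence "integral\<^sup>L torus_measure (\<lambda>x. (\<Sum>i\<in>I. c i * f i x) * chr (-k) x)
      = (\<Sum>i\<in>I. c i * integral\<^sup>L torus_measure (\<lambda>x. f i x * chr (-k) x))"
    using integrable_mult_chr[OF assms] by simp
  thus ?thesis by (simp only: fcoeff_altdef sum_distrib_left mult.left_commute)
qed

lemma integrable_chr: "integrable torus_measure (chr k)"
  using torus.integrable_const_bound[of "chr k" 1] by auto

section \<open>Uniqueness of Fourier coefficients on the torus\<close>

inductive trig_poly :: "(real^'d \<Rightarrow> complex) \<Rightarrow> bool" where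
  chr: "trig_poly (chr k)"
| add: "trig_poly S \<Longrightarrow> trig_poly T \<Longrightarrow> trig_poly (\<lambda>x. S x + T x)"
| scale: "trig_poly T \<Longrightarrow> trig_poly (\<lambda>x. c * T x)"

lemma trig_poly_const: "trig_poly (\<lambda>x. c)"
  using trig_poly.scale[OF trig_poly.chr[of 0], of c] by simp

lemma trig_poly_chr_mult: "trig_poly T \<Longrightarrow> trig_poly (\<lambda>x. chr k x * T x)"
proof (induction T rule: trig_poly.induct)
  case (chr j)
  show ?case using trig_poly.chr[of "k + j"] by (simp add: chr_add[abs_def])
next
  case (add S T)
  thus ?case using trig_poly.add by (simp add: distrib_left)
next
  case (scale T c)
  thus ?case using trig_poly.scale[of _ c] by (simp add: mult.left_commute)
qed

lemma trig_poly_mult: "trig_poly S \<Longrightarrow> trig_poly T \<Longrightarrow> trig_poly (\<lambda>x. S x * T x)"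
proof (induction S rule: trig_poly.induct)
  case (chr k)
  thus ?case by (rule trig_poly_chr_mult)
next
  case (add S1 S2)
  thus ?case using trig_poly.add by (simp add: distrib_right)
next
  case (scale S c)
  thus ?case using trig_poly.scale[of _ c] by (simp add: mult.assoc)
qed

lemma trig_poly_sum: "(\<And>i. i \<in> I \<Longrightarrow> trig_poly (T i)) \<Longrightarrow> trig_poly (\<lambda>x. \<Sum>i\<in>I. T i x)"
proof (induction I rule: infinite_finite_induct)
  case (insert i I)
  thus ?case using trig_poly.add[of "T i" "\<lambda>x. \<Sum>i\<in>I. T i x"] by simp
qed (simp_all add: trig_poly_const)

lemma integral_trig_poly_eq_0:
  assumes "integrable torus_measure f" "\<And>k. fcoeff f k = 0" "trig_poly T"
  shows "integrable torus_measure (\<lambda>x. f x * T x) \<and> integral\<^sup>L torus_measure (\<lambda>x. f x * T x) = 0"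
  using assms(3)
proof (induction T rule: trig_poly.induct)
  case (chr k)
  show ?case using assms(2)[of "-k"] integrable_mult_chr[OF assms(1)] by (simp add: fcoeff_altdef)
qed (auto simp: distrib_left mult.left_commute[of _ "_ :: complex"])

text \<open>The half-open cube is not compact, and on it trigonometric polynomials can approximate
  only periodic functions. Its image in complex space stays inside a compact ball, and ordinary real
  polynomials there pull back to trigonometric polynomials.\<close>

definition torus_emb :: "real^'d \<Rightarrow> complex^'d" where
  "torus_emb x = (\<chi> i. cis (x $ i))"

lemma trig_poly_Re_Im_torus_emb:
  fixes i :: "'d::finite"
  shows "trig_poly (\<lambda>x. of_real (Re (torus_emb x $ i)))" "trig_poly (\<lambda>x. of_real (Im (torus_emb x $ i)))"
proof -
  have chr_axis: "chr (axis i 1) x = cis (x $ i)" for x :: "real^'d"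
  proof -
    have "(\<Sum>j\<in>UNIV. real_of_int (axis i 1 $ j) * x $ j) = (\<Sum>j\<in>UNIV. if j = i then x $ i else 0)"
      by (intro sum.cong) (auto simp: axis_def)
    thus ?thesis by (simp add: chr_def)
  qed
  have "of_real (Re (torus_emb x $ i)) = 1 / 2 * (chr (axis i 1) x + chr (-axis i 1) x)"
    "of_real (Im (torus_emb x $ i)) = - \<i> / 2 * (chr (axis i 1) x + (-1) * chr (-axis i 1) x)" for x :: "real^'d"
    unfolding chr_uminus chr_axis by (simp_all add: torus_emb_def complex_eq_iff)
  thus "trig_poly (\<lambda>x. of_real (Re (torus_emb x $ i)))" "trig_poly (\<lambda>x. of_real (Im (torus_emb x $ i)))"
    by (simp_all only:) (intro trig_poly.intros)+
qed

text \<open>A real-linear functional on complex space combines the real and imaginary parts of the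
  coordinates, which pull back to cosines and sines of the \<open>x $ i\<close>.\<close>

lemma trig_poly_real_polynomial_function:
  "real_polynomial_function g \<Longrightarrow> trig_poly (\<lambda>x. of_real (g (torus_emb x)))"
proof (induction g rule: real_polynomial_function.induct)
  case (linear g)
  have "g (torus_emb x) = (\<Sum>b\<in>Basis. torus_emb x \<bullet> b * g b)" for x
  proof -
    interpret bounded_linear g by (rule linear)
    have "g (torus_emb x) = g (\<Sum>b\<in>Basis. (torus_emb x \<bullet> b) *\<^sub>R b)" by (simp only: euclidean_representation)
    thus ?thesis by (simp only: sum scaleR real_scaleR_def)
  qed
  moreover have "trig_poly (\<lambda>x. of_real (torus_emb x \<bullet> b * g b))" if b: "b \<in> Basis" for b
  proof -
    obtain i u where u: "b = axis i u" "u = 1 \<or> u = \<i>"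
      using b by (auto simp: Basis_vec_def Basis_complex_def)
    have "trig_poly (\<lambda>x. of_real (torus_emb x \<bullet> b))"
      using u trig_poly_Re_Im_torus_emb[of i] by (auto simp: inner_axis inner_complex_def)
    from trig_poly.scale[OF this, of "of_real (g b)"] show ?thesis by (simp add: mult.commute)
  qed
  ultimately show ?case by (simp only: of_real_sum) (rule trig_poly_sum)
next
  case (const c)
  show ?case by (rule trig_poly_const)
next
  case (add f g)
  thus ?case using trig_poly.add by simp
next
  case (mult f g)
  thus ?case using trig_poly_mult by simp
qed

lemma continuous_torus_emb: "continuous_on S torus_emb"
  unfolding torus_emb_def cis_conv_exp by (intro continuous_intros continuous_on_vec_lambda)

lemma norm_torus_emb: "norm (torus_emb (x :: real^'d)) \<le> real CARD('d)"
  using norm_le_l1_cart[of "\<chi> i. cmod (torus_emb x $ i)"] by (simp add: torus_emb_def norm_vec_def)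

context
  fixes f :: "real^'d \<Rightarrow> complex"
  assumes f_int: "integrable torus_measure f" and f_coeff: "\<And>k. fcoeff f k = 0"
begin

lemma torus_emb_measurable [measurable]: "torus_emb \<in> borel_measurable torus_measure"
  by (intro borel_measurable_torusI borel_measurable_continuous_onI continuous_torus_emb)

text \<open>Stone-Weierstrass on the ball \<open>K\<close> approximates \<open>h\<close> uniformly
  by polynomials, whose pullbacks integrate to 0 against \<open>f\<close>. The error is at most e
  times the L1 norm of \<open>f\<close>.\<close>

lemma integral_continuous_eq_0:
  fixes h :: "complex^'d \<Rightarrow> real"
  assumes h: "continuous_on UNIV h"
  shows "integral\<^sup>L torus_measure (\<lambda>x. f x * of_real (h (torus_emb x))) = 0"
proof -
  define K :: "(complex^'d) set" where "K = cball 0 (real CARD('d))"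
  have K: "compact K" "torus_emb x \<in> K" for x using norm_torus_emb by (auto simp: K_def)
  have hm: "(\<lambda>x. complex_of_real (h (torus_emb x))) \<in> borel_measurable torus_measure"
    using borel_measurable_continuous_onI[OF h] by measurable
  have "bounded (h ` K)"
    by (intro compact_imp_bounded compact_continuous_image continuous_on_subset[OF h] K) auto
  then obtain B where B: "\<And>z. z \<in> K \<Longrightarrow> \<bar>h z\<bar> \<le> B" by (auto simp: bounded_iff)
  have int_h: "integrable torus_measure (\<lambda>x. f x * of_real (h (torus_emb x)))"
    using B K by (intro integrable_mult_bounded[OF f_int hm, of B]) auto
  have "cmod (integral\<^sup>L torus_measure (\<lambda>x. f x * of_real (h (torus_emb x))))
      \<le> e * integral\<^sup>L torus_measure (\<lambda>x. cmod (f x))" if e: "0 < e" for e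
  proof -
    obtain g where g: "real_polynomial_function g" "\<And>z. z \<in> K \<Longrightarrow> \<bar>h z - g z\<bar> < e"
      using Stone_Weierstrass_real_polynomial_function[OF K(1) continuous_on_subset[OF h] e] by auto
    note T = integral_trig_poly_eq_0[OF f_int f_coeff trig_poly_real_polynomial_function[OF g(1)]]
    have "integral\<^sup>L torus_measure (\<lambda>x. f x * of_real (h (torus_emb x)))
        = integral\<^sup>L torus_measure (\<lambda>x. f x * of_real (h (torus_emb x)) - f x * of_real (g (torus_emb x)))"
      using T int_h by simp
    also have "cmod \<dots> \<le> integral\<^sup>L torus_measure (\<lambda>x. e * cmod (f x))"
    proof (rule order.trans[OF Bochner_Integration.integral_norm_bound], rule integral_mono)
      show "integrable torus_measure (\<lambda>x. cmod (f x * of_real (h (torus_emb x)) - f x * of_real (g (torus_emb x))))"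
        using T int_h by simp
      show "integrable torus_measure (\<lambda>x. e * cmod (f x))" using f_int by simp
      fix x :: "real^'d" assume "x \<in> space torus_measure"
      have "cmod (f x * of_real (h (torus_emb x)) - f x * of_real (g (torus_emb x)))
          = cmod (f x) * \<bar>h (torus_emb x) - g (torus_emb x)\<bar>"
        by (simp add: norm_mult flip: right_diff_distrib of_real_diff)
      also have "\<dots> \<le> cmod (f x) * e" using g(2)[OF K(2)] by (intro mult_left_mono) (auto intro: less_imp_le)
      finally show "cmod (f x * of_real (h (torus_emb x)) - f x * of_real (g (torus_emb x))) \<le> e * cmod (f x)"
        by (simp add: mult.commute)
    qed
    finally show ?thesis by simp
  qed
  note bound = this
  show ?thesis
  proof (rule ccontr)
    assume "\<not> ?thesis"
    hence pos: "0 < cmod (integral\<^sup>L torus_measure (\<lambda>x. f x * of_real (h (torus_emb x))))" by simp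
    define I where "I = integral\<^sup>L torus_measure (\<lambda>x. cmod (f x))"
    have I: "0 \<le> I" unfolding I_def by simp
    define J where "J = cmod (integral\<^sup>L torus_measure (\<lambda>x. f x * of_real (h (torus_emb x))))"
    \<comment> \<open>This choice of e makes the bound strictly smaller than \<open>J\<close>; the
      +1 covers a vanishing L1 norm.\<close>
    have "0 < J / (2 * (I + 1))" using pos I unfolding J_def by (intro divide_pos_pos) auto
    from bound[OF this] have "J \<le> J / (2 * (I + 1)) * I" unfolding I_def[symmetric] J_def[symmetric] .
    moreover have "J * I < J * (2 * (I + 1))" using pos I unfolding J_def by (intro mult_strict_left_mono) auto
    hence "J / (2 * (I + 1)) * I < J" using I by (simp add: field_simps)
    ultimately show False by simp
  qed
qed

text \<open>The indicator of an open set is the pointwise limit of truncated multiples of the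
  distance to the complement, and dominated convergence applies.\<close>

lemma integral_open_eq_0:
  assumes V: "open V"
  shows "integral\<^sup>L torus_measure (\<lambda>x. f x * indicator V (torus_emb x)) = 0"
\<comment> \<open>The whole space is treated apart because \<open>infdist\<close> to the empty set
  is 0 by convention.\<close>
proof (cases "V = UNIV")
  case True
  show ?thesis using integral_continuous_eq_0[of "\<lambda>_. 1"] True by simp
next
  case False
  define h where "h n z = min 1 (real n * infdist z (- V))" for n and z
  have h_cont: "continuous_on UNIV (h n)" for n
    unfolding h_def by (intro continuous_intros continuous_on_infdist)
  have h_lim: "(\<lambda>n. h n z) \<longlonglongrightarrow> indicator V z" for z
  proof (cases "z \<in> V")
    case True
    have "0 < infdist z (- V)"
      using infdist_pos_not_in_closed[of "- V" z] V True False by auto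
    hence "filterlim (\<lambda>n. real n * infdist z (- V)) at_top sequentially" by real_asymp
    hence "eventually (\<lambda>n. 1 \<le> real n * infdist z (- V)) sequentially" by (simp add: filterlim_at_top)
    hence "eventually (\<lambda>n. h n z = 1) sequentially" by eventually_elim (simp add: h_def)
    thus ?thesis using True by (simp add: tendsto_eventually)
  next
    case False
    thus ?thesis by (simp add: h_def)
  qed
  have "(\<lambda>n. integral\<^sup>L torus_measure (\<lambda>x. f x * of_real (h n (torus_emb x))))
     \<longlonglongrightarrow> integral\<^sup>L torus_measure (\<lambda>x. f x * indicator V (torus_emb x))"
  proof (rule integral_dominated_convergence[where w = "\<lambda>x. cmod (f x)"])
    have [measurable]: "V \<in> sets borel" "h n \<in> borel_measurable borel" for n
      using V borel_measurable_continuous_onI[OF h_cont] by auto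
    show "(\<lambda>x. f x * indicator V (torus_emb x)) \<in> borel_measurable torus_measure"
      "\<And>n. (\<lambda>x. f x * of_real (h n (torus_emb x))) \<in> borel_measurable torus_measure"
      using f_int by measurable
    show "integrable torus_measure (\<lambda>x. cmod (f x))" using f_int by simp
    show "AE x in torus_measure. (\<lambda>n. f x * of_real (h n (torus_emb x))) \<longlonglongrightarrow> f x * indicator V (torus_emb x)"
    proof (rule AE_I2)
      fix x :: "real^'d"
      have "(\<lambda>n. complex_of_real (h n (torus_emb x))) \<longlonglongrightarrow> of_real (indicator V (torus_emb x))"
        by (intro tendsto_of_real h_lim)
      thus "(\<lambda>n. f x * of_real (h n (torus_emb x))) \<longlonglongrightarrow> f x * indicator V (torus_emb x)"
        by (intro tendsto_mult tendsto_const) (cases "torus_emb x \<in> V", simp_all)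
    qed
    show "AE x in torus_measure. norm (f x * of_real (h n (torus_emb x))) \<le> cmod (f x)" for n
    proof (rule AE_I2)
      fix x :: "real^'d"
      have "\<bar>h n (torus_emb x)\<bar> \<le> 1" unfolding h_def by (auto simp: abs_le_iff min_def infdist_nonneg)
      thus "norm (f x * of_real (h n (torus_emb x))) \<le> cmod (f x)" by (simp add: norm_mult mult_left_le)
    qed
  qed
  thus ?thesis using integral_continuous_eq_0[OF h_cont] by (simp add: LIMSEQ_const_iff)
qed

text \<open>Dynkin's argument: open sets form an intersection-stable generator, and the sets with
  vanishing integral are closed under complements and countable disjoint unions.\<close>

lemma integral_borel_preimage_eq_0:
  assumes V: "V \<in> sets (borel :: (complex^'d) measure)"
  shows "set_lebesgue_integral torus_measure (torus_emb -` V \<inter> torus_cube) f = 0"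
proof -
  have eq: "set_lebesgue_integral torus_measure (torus_emb -` V \<inter> torus_cube) f
      = integral\<^sup>L torus_measure (\<lambda>x. f x * indicator V (torus_emb x))" for V
    unfolding set_lebesgue_integral_def by (intro Bochner_Integration.integral_cong) (auto simp: indicator_def)
  have V': "V \<in> sigma_sets UNIV {S. open S}" using V by (simp add: borel_def)
  have "Int_stable {S :: (complex^'d) set. open S}" by (auto simp: Int_stable_def)
  moreover have "{S :: (complex^'d) set. open S} \<subseteq> Pow UNIV" by simp
  ultimately show ?thesis using V'
  proof (induction rule: sigma_sets_induct_disjoint)
    case (basic A)
    thus ?case using integral_open_eq_0 by (simp add: eq)
  next
    case empty
    show ?case by (simp add: set_lebesgue_integral_def)
  next
    case (compl A)
    hence A: "A \<in> sets borel" by (simp add: borel_def)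
    have [measurable]: "f \<in> borel_measurable torus_measure" using f_int by simp
    have "integrable torus_measure (\<lambda>x. f x * indicator A (torus_emb x))"
      using A by (intro integrable_mult_bounded[OF f_int, of _ 1]) (measurable, auto simp: indicator_def)
    moreover have "(\<lambda>x. f x * indicator (UNIV - A) (torus_emb x)) = (\<lambda>x. f x - f x * indicator A (torus_emb x))"
      by (auto simp: fun_eq_iff indicator_def)
    moreover have "integral\<^sup>L torus_measure f = 0" using integral_continuous_eq_0[of "\<lambda>_. 1"] by simp
    ultimately show ?case using compl f_int by (simp add: eq)
  next
    case (union A)
    have A: "A i \<in> sets borel" for i using union by (auto simp: borel_def)
    have S: "torus_emb -` A i \<inter> torus_cube \<in> sets torus_measure" for i
      using measurable_sets[OF torus_emb_measurable A] by simp
    have "set_lebesgue_integral torus_measure (\<Union>i. torus_emb -` A i \<inter> torus_cube) f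
        = (\<Sum>i. set_lebesgue_integral torus_measure (torus_emb -` A i \<inter> torus_cube) f)"
    proof (rule lebesgue_integral_countable_add[OF S])
      show "(torus_emb -` A i \<inter> torus_cube) \<inter> (torus_emb -` A j \<inter> torus_cube) = {}" if "i \<noteq> j" for i j
        using disjoint_family_onD[OF union(1), of i j] that by auto
      show "set_integrable torus_measure (\<Union>i. torus_emb -` A i \<inter> torus_cube) f"
        using S f_int unfolding set_integrable_def by (intro integrable_mult_indicator sets.countable_UN) blast+
    qed
    moreover have "(\<Union>i. torus_emb -` A i \<inter> torus_cube) = torus_emb -` (\<Union>i. A i) \<inter> torus_cube" by auto
    ultimately show ?case using union by simp
  qed
qed

end

text \<open>\<open>Arg2pi\<close> jumps across the nonnegative reals, but it is constant on them and
  continuous off them. It supplies a Borel left inverse of \<open>torus_emb\<close>.\<close>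

lemma Arg2pi_measurable [measurable]: "Arg2pi \<in> borel_measurable borel"
proof (rule measurable_piecewise_restrict[of "{\<real>\<^sub>\<ge>\<^sub>0, - \<real>\<^sub>\<ge>\<^sub>0}"])
  have [measurable]: "\<real>\<^sub>\<ge>\<^sub>0 \<in> sets (borel :: complex measure)"
    by (intro borel_closed closed_nonneg_Reals_complex)
  show "\<Omega> \<inter> space borel \<in> sets borel" if "\<Omega> \<in> {\<real>\<^sub>\<ge>\<^sub>0, - \<real>\<^sub>\<ge>\<^sub>0 :: complex set}" for \<Omega>
    using that by auto
  fix \<Omega> :: "complex set" assume "\<Omega> \<in> {\<real>\<^sub>\<ge>\<^sub>0, - \<real>\<^sub>\<ge>\<^sub>0}"
  hence "continuous_on \<Omega> Arg2pi"
  proof (elim insertE)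
    assume "\<Omega> = \<real>\<^sub>\<ge>\<^sub>0"
    hence "Arg2pi z = 0" if "z \<in> \<Omega>" for z using that by (simp add: Arg2pi_eq_0 complex_nonneg_Reals_iff complex_is_Real_iff)
    thus ?thesis by (metis (no_types, lifting) continuous_on_cong continuous_on_const)
  qed (auto intro!: continuous_at_imp_continuous_on continuous_at_Arg2pi)
  thus "Arg2pi \<in> borel_measurable (restrict_space borel \<Omega>)" by (rule borel_measurable_continuous_on_restrict)
qed auto

text \<open>\<open>torus_emb\<close> has a Borel left inverse on the cube, so its preimages exhaust
  all Borel subsets of the cube. Hence \<open>f\<close> integrates to 0 over every measurable set,
  which determines its real and imaginary parts.\<close>

theorem fcoeff_eq_0_imp_AE_eq_0:
  fixes f :: "real^'d \<Rightarrow> complex"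
  assumes f: "integrable torus_measure f" "\<And>k. fcoeff f k = 0"
  shows "AE x in torus_measure. f x = 0"
proof -
  define G :: "complex^'d \<Rightarrow> real^'d" where "G z = (\<chi> i. Arg2pi (z $ i))" for z
  have nth [measurable]: "(\<lambda>z :: complex^'d. z $ i) \<in> borel_measurable borel" for i
    by (intro borel_measurable_continuous_onI continuous_intros)
  have G [measurable]: "G \<in> borel_measurable borel"
    unfolding borel_measurable_euclidean_space[of G]
    by (auto simp: Basis_vec_def inner_axis G_def)
  have GE: "G (torus_emb x) = x" if "x \<in> torus_cube" for x
  proof -
    have "Arg2pi (cis (x $ i)) = x $ i" for i
      using that Arg2pi_exp[of "\<i> * x $ i"] by (simp add: torus_cube_def cis_conv_exp)
    thus ?thesis by (simp add: G_def torus_emb_def vec_eq_iff)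
  qed
  have zero: "set_lebesgue_integral torus_measure A f = 0" if A: "A \<in> sets torus_measure" for A
  proof -
    have "A \<in> sets lebesgue" "A \<subseteq> torus_cube"
      using A by (auto simp: sets_restrict_space_iff)
    \<comment> \<open>A Lebesgue set differs from a Borel set by a null set, which the integral does
      not see.\<close>
    then obtain S N N' where S: "A = S \<union> N" "N \<subseteq> N'" "N' \<in> null_sets lborel" "S \<in> sets lborel"
      by (meson sets_completionE)
    have Sb: "S \<in> sets borel" "S \<subseteq> torus_cube" using S \<open>A \<subseteq> torus_cube\<close> by auto
    have pre: "torus_emb -` (G -` S) \<inter> torus_cube = S"
      using GE Sb(2) by auto
    have "G -` S \<in> sets borel" using measurable_sets[OF G Sb(1)] by simp
    from integral_borel_preimage_eq_0[OF f this] have "set_lebesgue_integral torus_measure S f = 0"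
      unfolding pre .
    moreover have "set_lebesgue_integral torus_measure A f = set_lebesgue_integral torus_measure S f"
      unfolding set_lebesgue_integral_def
    proof (rule integral_cong_AE)
      have "S \<in> sets torus_measure" using Sb by (auto simp: sets_restrict_space_iff)
      thus "(\<lambda>x. indicator A x *\<^sub>R f x) \<in> borel_measurable torus_measure"
        "(\<lambda>x. indicator S x *\<^sub>R f x) \<in> borel_measurable torus_measure"
        using A f(1) by auto
      have "AE x in lebesgue. x \<notin> N'"
        using S(3) by (intro AE_not_in null_sets_completionI)
      hence "AE x in torus_measure. x \<notin> N'" by (subst AE_restrict_space_iff) auto
      thus "AE x in torus_measure. indicator A x *\<^sub>R f x = indicator S x *\<^sub>R f x"
      proof eventually_elim
        case (elim x)
        thus ?case using S by (auto simp: indicator_def)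
      qed
    qed
    ultimately show ?thesis by simp
  qed
  have set_int: "set_integrable torus_measure A f" if "A \<in> sets torus_measure" for A
    using that f(1) unfolding set_integrable_def by (intro integrable_mult_indicator) auto
  have "AE x in torus_measure. Re (f x) = 0"
  proof (rule density_unique_real)
    show "set_lebesgue_integral torus_measure A (\<lambda>x. Re (f x)) = set_lebesgue_integral torus_measure A (\<lambda>x. 0)"
      if "A \<in> sets torus_measure" for A
      using zero[OF that] integral_Re[OF set_int[OF that, unfolded set_integrable_def]]
      by (simp add: set_lebesgue_integral_def)
  qed (use f in auto)
  moreover have "AE x in torus_measure. Im (f x) = 0"
  proof (rule density_unique_real)
    show "set_lebesgue_integral torus_measure A (\<lambda>x. Im (f x)) = set_lebesgue_integral torus_measure A (\<lambda>x. 0)"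
      if "A \<in> sets torus_measure" for A
      using zero[OF that] integral_Im[OF set_int[OF that, unfolded set_integrable_def]]
      by (simp add: set_lebesgue_integral_def)
  qed (use f in auto)
  ultimately show ?thesis by eventually_elim (simp add: complex_eq_iff)
qed

section \<open>Approximation numbers as tail sums\<close>

lemma L2_torus_integrable:
  assumes "L2_torus f"
  shows "integrable torus_measure f"
proof (rule Bochner_Integration.integrable_bound)
  show "integrable torus_measure (\<lambda>x. 1 + (cmod (f x))\<^sup>2)"
    using assms by (auto simp: L2_torus_def)
  show "f \<in> borel_measurable torus_measure" using assms by (auto simp: L2_torus_def)
  have "cmod z \<le> 1 + (cmod z)\<^sup>2" for z
    using zero_le_power2[of "cmod z - 1"] norm_ge_zero[of z] unfolding power2_diff by (smt (verit) one_power2)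
  thus "AE x in torus_measure. norm (f x) \<le> norm (1 + (cmod (f x))\<^sup>2)" by (intro AE_I2) simp
qed

lemma L2_torus_bounded:
  fixes f :: "real^'d \<Rightarrow> complex"
  assumes "f \<in> borel_measurable torus_measure" "AE x in torus_measure. cmod (f x) \<le> B"
  shows "L2_torus f"
proof -
  have "AE x in torus_measure. norm ((cmod (f x))\<^sup>2) \<le> B\<^sup>2"
    using assms(2) by eventually_elim (simp add: power_mono)
  moreover have "(\<lambda>x. (cmod (f x))\<^sup>2) \<in> borel_measurable torus_measure" using assms(1) by measurable
  ultimately show ?thesis
    unfolding L2_torus_def by (intro conjI assms(1) torus.integrable_const_bound)
qed

text \<open>Integrate |f - S|^2 >= 0, where \<open>S\<close> is the partial Fourier sum over
  \<open>F\<close>. The factor (2 pi)^d appears because \<open>fcoeff\<close> is normalised while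
  \<open>torus_measure\<close> is not.\<close>

lemma bessel_torus:
  fixes f :: "real^'d \<Rightarrow> complex"
  assumes f: "L2_torus f" and F: "finite F"
  shows "(2 * pi) ^ CARD('d) * (\<Sum>k\<in>F. (cmod (fcoeff f k))\<^sup>2) \<le> integral\<^sup>L torus_measure (\<lambda>x. (cmod (f x))\<^sup>2)"
proof -
  define P where "P = (2 * pi) ^ CARD('d)"
  define c where "c = fcoeff f"
  define S where "S x = (\<Sum>k\<in>F. c k * chr k x)" for x
  have P: "0 < P" unfolding P_def by simp
  have f_int: "integrable torus_measure f" by (rule L2_torus_integrable[OF f])
  have Sm: "S \<in> borel_measurable torus_measure" unfolding S_def[abs_def] by measurable
  have Sb: "cmod (S x) \<le> (\<Sum>k\<in>F. cmod (c k))" for x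
    unfolding S_def by (rule order.trans[OF norm_sum]) (simp add: norm_mult)
  have S_int: "integrable torus_measure S"
    using torus.integrable_const_bound[OF _ Sm, of "\<Sum>k\<in>F. cmod (c k)"] Sb by auto
  have Sc: "fcoeff S k = c k" if "k \<in> F" for k
  proof -
    have "fcoeff S k = (\<Sum>j\<in>F. c j * fcoeff (chr j) k)"
      unfolding S_def[abs_def] by (rule fcoeff_sum) (rule integrable_chr)
    also have "\<dots> = (\<Sum>j\<in>F. if j = k then c k else 0)" by (intro sum.cong) (auto simp: fcoeff_chr)
    finally show ?thesis using that F by simp
  qed
  \<comment> \<open>Pairing with \<open>S\<close> reads off coefficients; used for \<open>f\<close>
    and for \<open>S\<close> itself, both pairings give the same value.\<close>
  have cnjS: "integrable torus_measure (\<lambda>x. g x * cnj (S x)) \<and>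
      integral\<^sup>L torus_measure (\<lambda>x. g x * cnj (S x)) = P * (\<Sum>k\<in>F. cnj (c k) * fcoeff g k)"
    if g: "integrable torus_measure g" for g
  proof -
    have eq: "(\<lambda>x. g x * cnj (S x)) = (\<lambda>x. \<Sum>k\<in>F. cnj (c k) * (g x * chr (-k) x))"
      by (simp add: fun_eq_iff S_def cnj_sum sum_distrib_left chr_uminus mult_ac)
    have "integral\<^sup>L torus_measure (\<lambda>x. g x * chr (-k) x) = P * fcoeff g k" for k
      using P unfolding fcoeff_altdef P_def by simp
    hence "integral\<^sup>L torus_measure (\<lambda>x. g x * cnj (S x)) = (\<Sum>k\<in>F. cnj (c k) * (P * fcoeff g k))"
      unfolding eq using integrable_mult_chr[OF g] by simp
    moreover have "integrable torus_measure (\<lambda>x. g x * cnj (S x))"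
      unfolding eq by (intro Bochner_Integration.integrable_sum integrable_mult_right integrable_mult_chr g)
    ultimately show ?thesis by (simp add: sum_distrib_left mult_ac)
  qed
  define N where "N = (\<Sum>k\<in>F. (cmod (c k))\<^sup>2)"
  have N: "(\<Sum>k\<in>F. cnj (c k) * c k) = of_real N"
    unfolding N_def of_real_sum complex_norm_square by (simp add: mult.commute)
  have i1: "integral\<^sup>L torus_measure (\<lambda>x. f x * cnj (S x)) = of_real (P * N)"
    using cnjS[OF f_int] N by (simp add: c_def)
  have i2: "integral\<^sup>L torus_measure (\<lambda>x. S x * cnj (S x)) = of_real (P * N)"
  proof -
    have "(\<Sum>k\<in>F. cnj (c k) * fcoeff S k) = of_real N" unfolding N[symmetric] using Sc by simp
    thus ?thesis using cnjS[OF S_int] by simp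
  qed
  have pt: "0 \<le> (cmod (f x))\<^sup>2 - 2 * Re (f x * cnj (S x)) + Re (S x * cnj (S x))" for x
  proof -
    have "0 \<le> (cmod (f x - S x))\<^sup>2" by simp
    also have "\<dots> = (cmod (f x))\<^sup>2 - 2 * Re (f x * cnj (S x)) + Re (S x * cnj (S x))"
      unfolding cmod_power2 by (simp add: power2_eq_square algebra_simps)
    finally show ?thesis .
  qed
  have lin: "integral\<^sup>L torus_measure (\<lambda>x. a x - 2 * b x + h x)
      = integral\<^sup>L torus_measure a - 2 * integral\<^sup>L torus_measure b + integral\<^sup>L torus_measure h"
    if "integrable torus_measure a" "integrable torus_measure b" "integrable torus_measure h"
    for a b h :: "real^'d \<Rightarrow> real"
    using that by simp
  have "0 \<le> integral\<^sup>L torus_measure (\<lambda>x. (cmod (f x))\<^sup>2 - 2 * Re (f x * cnj (S x)) + Re (S x * cnj (S x)))"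
    by (intro integral_nonneg_AE AE_I2 pt)
  also have "\<dots> = integral\<^sup>L torus_measure (\<lambda>x. (cmod (f x))\<^sup>2) - 2 * (P * N) + P * N"
  proof -
    have "integral\<^sup>L torus_measure (\<lambda>x. Re (f x * cnj (S x))) = P * N"
      by (subst integral_Re) (use cnjS[OF f_int] in blast, simp only: i1 Re_complex_of_real)
    moreover have "integral\<^sup>L torus_measure (\<lambda>x. Re (S x * cnj (S x))) = P * N"
      by (subst integral_Re) (use cnjS[OF S_int] in blast, simp only: i2 Re_complex_of_real)
    moreover have "integrable torus_measure (\<lambda>x. Re (f x * cnj (S x)))" "integrable torus_measure (\<lambda>x. Re (S x * cnj (S x)))"
      using cnjS[OF f_int] cnjS[OF S_int] integrable_Re by blast+
    moreover have "integrable torus_measure (\<lambda>x. (cmod (f x))\<^sup>2)" using f by (simp add: L2_torus_def)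
    ultimately show ?thesis
      by (subst lin) (simp_all only:)
  qed
  finally show ?thesis unfolding P_def[symmetric] c_def[symmetric] N_def[symmetric] by linarith
qed

text \<open>The absolutely convergent series defines an integrable function with the same
  coefficients, by termwise integration; the uniqueness theorem does the rest.\<close>

lemma fourier_inversion_AE:
  fixes f :: "real^'d \<Rightarrow> complex" and e :: "nat \<Rightarrow> int^'d"
  assumes f: "integrable torus_measure f" and e: "bij e" and sm: "summable (\<lambda>j. cmod (fcoeff f (e j)))"
  shows "AE x in torus_measure. f x = (\<Sum>j. fcoeff f (e j) * chr (e j) x)"
proof -
  define h where "h j x = fcoeff f (e j) * chr (e j) x" for j and x
  define g where "g x = (\<Sum>j. h j x)" for x
  have h_norm: "cmod (h j x) = cmod (fcoeff f (e j))" for j x by (simp add: h_def norm_mult)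
  have h_int: "integrable torus_measure (h j)" for j
    unfolding h_def by (intro integrable_mult_right integrable_chr)
  have h_sum: "summable (\<lambda>j. norm (h j x))" for x using sm by (simp add: h_norm)
  have h_isum: "summable (\<lambda>j. \<integral>x. norm (h j x) \<partial>torus_measure)"
    using sm by (simp add: h_norm summable_mult)
  have g_int: "integrable torus_measure g"
    unfolding g_def[abs_def] using h_int h_sum h_isum by (intro integrable_suminf) auto
  have g_coeff: "fcoeff g k = fcoeff f k" for k
  proof -
    define c where "c = complex_of_real (1 / (2 * pi) ^ CARD('d))"
    have "(\<lambda>j. integral\<^sup>L torus_measure (\<lambda>x. h j x * chr (-k) x)) sums
        (integral\<^sup>L torus_measure (\<lambda>x. \<Sum>j. h j x * chr (-k) x))"
    proof (rule sums_integral)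
      show "integrable torus_measure (\<lambda>x. h j x * chr (-k) x)" for j by (rule integrable_mult_chr[OF h_int])
      show "AE x in torus_measure. summable (\<lambda>j. norm (h j x * chr (-k) x))"
        using h_sum by (simp add: norm_mult)
      show "summable (\<lambda>j. \<integral>x. norm (h j x * chr (-k) x) \<partial>torus_measure)"
        using h_isum by (simp add: norm_mult)
    qed
    hence "(\<lambda>j. c * integral\<^sup>L torus_measure (\<lambda>x. h j x * chr (-k) x)) sums
        (c * integral\<^sup>L torus_measure (\<lambda>x. \<Sum>j. h j x * chr (-k) x))" by (rule sums_mult)
    moreover have "(\<Sum>j. h j x * chr (-k) x) = g x * chr (-k) x" for x
      unfolding g_def by (rule suminf_mult2[OF summable_norm_cancel[OF h_sum], symmetric])
    moreover have "c * integral\<^sup>L torus_measure (\<lambda>x. h j x * chr (-k) x) = (if j = inv e k then fcoeff f k else 0)" for j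
    proof -
      have "fcoeff (h j) k = fcoeff f (e j) * fcoeff (chr (e j)) k"
        using fcoeff_sum[of "{()}" "\<lambda>_. chr (e j)" "\<lambda>_. fcoeff f (e j)" k]
        by (simp add: h_def[abs_def] integrable_chr)
      also have "\<dots> = (if j = inv e k then fcoeff f k else 0)"
        using e by (auto simp: fcoeff_chr bij_def surj_f_inv_f)
      finally show ?thesis by (simp only: fcoeff_altdef c_def)
    qed
    ultimately have "(\<lambda>j. if j = inv e k then fcoeff f k else 0) sums fcoeff g k"
      by (simp only: fcoeff_altdef c_def)
    moreover have "(\<lambda>j. if j = inv e k then fcoeff f k else 0) sums fcoeff f k"
      using sums_single[of "inv e k" "\<lambda>_. fcoeff f k"] by simp
    ultimately show ?thesis by (rule sums_unique2)
  qed
  have "AE x in torus_measure. 1 * f x + (-1) * g x = 0"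
  proof (rule fcoeff_eq_0_imp_AE_eq_0)
    show "integrable torus_measure (\<lambda>x. 1 * f x + (-1) * g x)" using f g_int by simp
    show "fcoeff (\<lambda>x. 1 * f x + (-1) * g x) k = 0" for k
      using fcoeff_linear[OF f g_int, of 1 "-1" k] g_coeff by simp
  qed
  thus ?thesis by eventually_elim (simp add: g_def h_def)
qed

section \<open>The exact formula for weights that are at least 1, sorted by \<open>e\<close>, with
  summable reciprocals\<close>

context
  fixes s :: real and r :: ereal and e :: "nat \<Rightarrow> int^'d"
  assumes bij_e: "bij e"
    and weight_ge_1: "\<And>k :: int^'d. 1 \<le> mix_weight s r k"
    and weight_mono: "\<And>i j. i \<le> j \<Longrightarrow> mix_weight s r (e i) \<le> mix_weight s r (e j)"
    and weight_summable: "summable (\<lambda>j. 1 / mix_weight s r (e j))"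
begin

lemma weight_pos: "0 < mix_weight s r (k :: int^'d)"
  using weight_ge_1[of k] by simp

lemma Hmix_L2: "f \<in> Hmix s r \<Longrightarrow> L2_torus f"
  by (simp add: Hmix_def)

text \<open>Passes from the unordered sum in the norm to a series along \<open>e\<close>, for which
  tails make sense.\<close>

lemma Hmix_norm_sums:
  fixes f :: "real^'d \<Rightarrow> complex"
  assumes "f \<in> Hmix s r"
  shows "(\<lambda>j. mix_weight s r (e j) * (cmod (fcoeff f (e j)))\<^sup>2) sums (Hmix_norm s r f)\<^sup>2"
proof -
  define h where "h k = mix_weight s r k * (cmod (fcoeff f k))\<^sup>2" for k
  have h: "0 \<le> h k" for k unfolding h_def using weight_pos[of k] by simp
  have "h summable_on UNIV" using assms by (simp add: Hmix_def h_def[abs_def])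
  hence "(h has_sum infsum h UNIV) UNIV" by (rule has_sum_infsum)
  hence "((\<lambda>j. h (e j)) has_sum infsum h UNIV) UNIV"
    using bij_e by (subst has_sum_reindex_bij_betw[where B = UNIV]) auto
  hence "(\<lambda>j. h (e j)) sums infsum h UNIV" by (rule has_sum_imp_sums)
  moreover have "(Hmix_norm s r f)\<^sup>2 = infsum h UNIV"
    using infsum_nonneg[of UNIV h] h by (simp add: Hmix_norm_def h_def[abs_def])
  ultimately show ?thesis by (simp add: h_def)
qed

lemma Hmix_norm_nonneg: "0 \<le> Hmix_norm s r (f :: real^'d \<Rightarrow> complex)"
  unfolding Hmix_norm_def using weight_pos by (intro real_sqrt_ge_zero infsum_nonneg) (simp add: less_imp_le)

lemma cmod_fcoeff_le_Hmix_norm: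
  fixes f :: "real^'d \<Rightarrow> complex"
  assumes "f \<in> Hmix s r"
  shows "cmod (fcoeff f k) \<le> Hmix_norm s r f"
proof (rule power2_le_imp_le[OF _ Hmix_norm_nonneg])
  obtain j where j: "k = e j" using bij_e by (metis bij_pointE)
  have "1 * (cmod (fcoeff f k))\<^sup>2 \<le> mix_weight s r (e j) * (cmod (fcoeff f (e j)))\<^sup>2"
    unfolding j using weight_ge_1 by (intro mult_right_mono) auto
  also have "\<dots> = (\<Sum>i\<in>{j}. mix_weight s r (e i) * (cmod (fcoeff f (e i)))\<^sup>2)" by simp
  also have "\<dots> \<le> (Hmix_norm s r f)\<^sup>2"
    using Hmix_norm_sums[OF assms] weight_pos
    by (subst sums_unique[OF Hmix_norm_sums[OF assms]], intro sum_le_suminf)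
       (auto simp: sums_iff less_imp_le)
  finally show "(cmod (fcoeff f k))\<^sup>2 \<le> (Hmix_norm s r f)\<^sup>2" by simp
qed

lemma bounded_lin_functional_fcoeff: "bounded_lin_functional s r (\<lambda>f. fcoeff f (k :: int^'d))"
  unfolding bounded_lin_functional_def
  by (intro conjI ballI allI exI[of _ 1] fcoeff_linear)
     (simp_all add: L2_torus_integrable Hmix_L2 cmod_fcoeff_le_Hmix_norm)

definition weight_tail :: "nat \<Rightarrow> real" where
  "weight_tail m = (\<Sum>j. 1 / mix_weight s r (e (j + m)))"

lemma weight_tail_summable: "summable (\<lambda>j. 1 / mix_weight s r (e (j + m)))"
  using weight_summable by (simp add: summable_iff_shift[of "\<lambda>j. 1 / mix_weight s r (e j)"])

lemma weight_tail_pos: "0 < weight_tail m"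
  unfolding weight_tail_def using weight_pos by (intro suminf_pos weight_tail_summable) simp

text \<open>Cauchy-Schwarz after writing each coefficient as w^(-1/2) times w^(1/2) |c|: the first
  factors square-sum to the tail, the second to at most the squared norm.\<close>

lemma fcoeff_tail_bound:
  fixes f :: "real^'d \<Rightarrow> complex"
  assumes f: "f \<in> Hmix s r" "Hmix_norm s r f \<le> 1"
  shows "summable (\<lambda>j. cmod (fcoeff f (e (j + m))))"
    and "(\<Sum>j. cmod (fcoeff f (e (j + m)))) \<le> sqrt (weight_tail m)"
proof -
  define w where "w j = mix_weight s r (e (j + m))" for j
  define x where "x j = cmod (fcoeff f (e (j + m)))" for j
  have w: "0 < w j" for j unfolding w_def by (rule weight_pos)
  have part: "(\<Sum>j<N. x j) \<le> sqrt (weight_tail m)" for N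
  proof -
    have "(\<Sum>j<N. x j)\<^sup>2 = (\<Sum>j<N. (1 / sqrt (w j)) * (sqrt (w j) * x j))\<^sup>2"
      using w by (simp add: less_imp_neq[symmetric])
    also have "\<dots> \<le> (\<Sum>j<N. (1 / sqrt (w j))\<^sup>2) * (\<Sum>j<N. (sqrt (w j) * x j)\<^sup>2)"
      by (rule Cauchy_Schwarz_ineq_sum)
    also have "\<dots> = (\<Sum>j<N. 1 / w j) * (\<Sum>j<N. w j * (x j)\<^sup>2)"
      using w by (simp add: power_mult_distrib power_divide less_imp_le)
    also have "\<dots> \<le> weight_tail m * 1"
    proof (intro mult_mono)
      show "(\<Sum>j<N. 1 / w j) \<le> weight_tail m"
        unfolding weight_tail_def using w weight_tail_summable[of m]
        by (simp add: w_def[symmetric]) (intro sum_le_suminf, auto simp: less_imp_le)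
      have nn: "0 \<le> mix_weight s r (e i) * (cmod (fcoeff f (e i)))\<^sup>2" for i
        using weight_pos[of "e i"] by simp
      have "(\<Sum>j<N. w j * (x j)\<^sup>2) = (\<Sum>i\<in>{m..<N + m}. mix_weight s r (e i) * (cmod (fcoeff f (e i)))\<^sup>2)"
        using sum.shift_bounds_nat_ivl[of "\<lambda>i. mix_weight s r (e i) * (cmod (fcoeff f (e i)))\<^sup>2" 0 m N]
        by (simp add: w_def x_def atLeast0LessThan)
      also have "\<dots> \<le> (\<Sum>i. mix_weight s r (e i) * (cmod (fcoeff f (e i)))\<^sup>2)"
        using Hmix_norm_sums[OF f(1)] nn by (intro sum_le_suminf) (auto simp: sums_iff)
      also have "\<dots> = (Hmix_norm s r f)\<^sup>2" using Hmix_norm_sums[OF f(1)] by (simp add: sums_iff)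
      also have "\<dots> \<le> 1" using f(2) Hmix_norm_nonneg[of f] by (simp add: power_le_one)
      finally show "(\<Sum>j<N. w j * (x j)\<^sup>2) \<le> 1" .
      show "0 \<le> (\<Sum>j<N. w j * (x j)\<^sup>2)" using w by (intro sum_nonneg) (simp add: less_imp_le)
    qed (use weight_tail_pos[of m] in auto)
    finally show ?thesis using real_le_rsqrt by simp
  qed
  show sm: "summable (\<lambda>j. cmod (fcoeff f (e (j + m))))"
    using part by (intro summableI_nonneg_bounded[of _ "sqrt (weight_tail m)"]) (auto simp: x_def)
  show "(\<Sum>j. cmod (fcoeff f (e (j + m)))) \<le> sqrt (weight_tail m)"
    using part by (intro suminf_le_const[OF sm]) (auto simp: x_def)
qed

lemma approx_number_upper:
  assumes n: "1 \<le> n"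
  shows "approx_number TYPE('d) s r n \<le> ereal (sqrt (weight_tail (n - 1)))"
proof -
  define m where "m = n - 1"
  define A :: "(real^'d \<Rightarrow> complex) \<Rightarrow> real^'d \<Rightarrow> complex" where
    "A f x = (\<Sum>j<m. fcoeff f (e j) * chr (e j) x)" for f x
  have "finite_rank_op s r n A"
    unfolding finite_rank_op_def
  proof (intro exI conjI allI impI)
    show "m < n" using n by (simp add: m_def)
    show "A f x = (\<Sum>j<m. fcoeff f (e j) * chr (e j) x)" for f x by (rule A_def)
    show "bounded_lin_functional s r (\<lambda>f. fcoeff f (e j))" for j by (rule bounded_lin_functional_fcoeff)
    show "chr (e j) \<in> borel_measurable torus_measure" for j by simp
    have "Linf_norm (chr (e j)) \<le> ereal 1" for j
      unfolding Linf_norm_def by (intro esssup_I) auto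
    thus "Linf_norm (chr (e j)) < \<infinity>" for j by (rule order.strict_trans1) simp
  qed
  hence "approx_number TYPE('d) s r n
      \<le> (SUP f \<in> {f \<in> Hmix s r. Hmix_norm s r f \<le> 1}. Linf_norm (\<lambda>x. f x - A f x))"
    unfolding approx_number_def by (intro INF_lower) simp
  also have "\<dots> \<le> ereal (sqrt (weight_tail m))"
  proof (rule SUP_least)
    fix f :: "real^'d \<Rightarrow> complex" assume "f \<in> {f \<in> Hmix s r. Hmix_norm s r f \<le> 1}"
    hence f: "f \<in> Hmix s r" "Hmix_norm s r f \<le> 1" by auto
    have fi: "integrable torus_measure f" using f by (intro L2_torus_integrable Hmix_L2)
    have [measurable]: "f \<in> borel_measurable torus_measure" using fi by simp
    have Am: "A f \<in> borel_measurable torus_measure" unfolding A_def[abs_def] by measurable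
    \<comment> \<open>The tail from index 0 is the full series, whose absolute convergence is what
      Fourier inversion requires.\<close>
    have sm: "summable (\<lambda>j. cmod (fcoeff f (e j)))" using fcoeff_tail_bound(1)[OF f, of 0] by simp
    show "Linf_norm (\<lambda>x. f x - A f x) \<le> ereal (sqrt (weight_tail m))"
      unfolding Linf_norm_def
    proof (rule esssup_I)
      show "(\<lambda>x. ereal (cmod (f x - A f x))) \<in> borel_measurable torus_measure" using Am by measurable
      show "AE x in torus_measure. ereal (cmod (f x - A f x)) \<le> ereal (sqrt (weight_tail m))"
        using fourier_inversion_AE[OF fi bij_e sm]
      proof eventually_elim
        case (elim x)
        define h where "h j = fcoeff f (e j) * chr (e j) x" for j
        have hn: "norm (h j) = cmod (fcoeff f (e j))" for j by (simp add: h_def norm_mult)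
        have hs: "summable (\<lambda>j. norm (h j))" using sm by (simp add: hn)
        have "f x - A f x = (\<Sum>j. h (j + m))"
          using suminf_split_initial_segment[OF summable_norm_cancel[OF hs], of m] elim
          by (simp add: h_def A_def)
        also have "norm \<dots> \<le> (\<Sum>j. norm (h (j + m)))"
          using hs by (intro summable_norm) (simp add: summable_iff_shift[of "\<lambda>j. norm (h j)"])
        also have "\<dots> \<le> sqrt (weight_tail m)" unfolding hn by (rule fcoeff_tail_bound(2)[OF f])
        finally show ?case by simp
      qed
    qed
  qed
  finally show ?thesis by (simp add: m_def)
qed

lemma Hmix_trig_sum:
  fixes F :: "(int^'d) set"
  assumes F: "finite F"
  shows "(\<lambda>x. \<Sum>k\<in>F. c k * chr k x) \<in> Hmix s r"
    and "(Hmix_norm s r (\<lambda>x. \<Sum>k\<in>F. c k * chr k x))\<^sup>2 = (\<Sum>k\<in>F. mix_weight s r k * (cmod (c k))\<^sup>2)"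
proof -
  define f :: "real^'d \<Rightarrow> complex" where "f x = (\<Sum>k\<in>F. c k * chr k x)" for x
  have coeff: "fcoeff f k = (if k \<in> F then c k else 0)" for k
  proof -
    have "fcoeff f k = (\<Sum>j\<in>F. c j * fcoeff (chr j) k)"
      unfolding f_def[abs_def] by (rule fcoeff_sum) (rule integrable_chr)
    also have "\<dots> = (\<Sum>j\<in>F. if j = k then c k else 0)" by (intro sum.cong) (auto simp: fcoeff_chr)
    finally show ?thesis using F by simp
  qed
  have hs: "((\<lambda>k. mix_weight s r k * (cmod (fcoeff f k))\<^sup>2) has_sum (\<Sum>k\<in>F. mix_weight s r k * (cmod (c k))\<^sup>2)) UNIV"
  proof -
    have "((\<lambda>k. mix_weight s r k * (cmod (c k))\<^sup>2) has_sum (\<Sum>k\<in>F. mix_weight s r k * (cmod (c k))\<^sup>2)) F"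
      using F by (rule has_sum_finite)
    thus ?thesis by (subst has_sum_cong_neutral[where T = F and g = "\<lambda>k. mix_weight s r k * (cmod (c k))\<^sup>2"])
      (auto simp: coeff)
  qed
  have "f \<in> borel_measurable torus_measure" unfolding f_def[abs_def] by measurable
  moreover have "AE x in torus_measure. cmod (f x) \<le> (\<Sum>k\<in>F. cmod (c k))"
    unfolding f_def by (intro AE_I2 order.trans[OF norm_sum]) (simp add: norm_mult)
  ultimately have "L2_torus f" by (rule L2_torus_bounded)
  thus "(\<lambda>x. \<Sum>k\<in>F. c k * chr k x) \<in> Hmix s r"
    using has_sum_imp_summable[OF hs] unfolding f_def[abs_def, symmetric] by (simp add: Hmix_def)
  have "0 \<le> (\<Sum>k\<in>F. mix_weight s r k * (cmod (c k))\<^sup>2)"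
    using weight_pos by (intro sum_nonneg) (simp add: less_imp_le)
  thus "(Hmix_norm s r (\<lambda>x. \<Sum>k\<in>F. c k * chr k x))\<^sup>2 = (\<Sum>k\<in>F. mix_weight s r k * (cmod (c k))\<^sup>2)"
    unfolding f_def[abs_def, symmetric] by (simp add: Hmix_norm_def infsumI[OF hs])
qed

lemma bounded_lin_functional_sum:
  fixes F :: "(int^'d) set"
  assumes l: "bounded_lin_functional s r l" and F: "finite F"
  shows "l (\<lambda>x. \<Sum>k\<in>F. c k * chr k x) = (\<Sum>k\<in>F. c k * l (chr k))"
proof -
  have lin: "l (\<lambda>x. a * f x + b * h x) = a * l f + b * l h" if "f \<in> Hmix s r" "h \<in> Hmix s r" for f h a b
    using l that unfolding bounded_lin_functional_def by blast
  have chr: "chr k \<in> Hmix s r" for k :: "int^'d" using Hmix_trig_sum(1)[of "{k}" "\<lambda>_. 1"] by simp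
  show ?thesis using F
  proof (induction F rule: finite_induct)
    \<comment> \<open>Linearity is assumed for two-term combinations within the space, so the zero
      function is written as one with zero coefficients.\<close>
    case empty
    show ?case using lin[OF chr[of 0] chr[of 0], of 0 0] by simp
  next
    case (insert k F)
    have "l (\<lambda>x. c k * chr k x + 1 * (\<Sum>k\<in>F. c k * chr k x)) = c k * l (chr k) + 1 * l (\<lambda>x. \<Sum>k\<in>F. c k * chr k x)"
      by (rule lin[OF chr Hmix_trig_sum(1)[OF insert.hyps(1)]])
    thus ?case using insert by simp
  qed
qed

text \<open>Only the values of \<open>A\<close> on characters matter. Their Fourier coefficients on
  a finite set of frequencies form a matrix of rank at most \<open>m\<close>, to which the
  finite-dimensional distance estimate applies.\<close>

lemma finite_rank_error_bound:
  fixes A :: "(real^'d \<Rightarrow> complex) \<Rightarrow> real^'d \<Rightarrow> complex"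
  assumes A: "finite_rank_op s r n A" and n: "1 \<le> n" and B: "0 \<le> B"
    and bound: "\<And>f. f \<in> Hmix s r \<Longrightarrow> Hmix_norm s r f \<le> 1 \<Longrightarrow> Linf_norm (\<lambda>x. f x - A f x) \<le> ereal B"
  shows "weight_tail (n - 1) \<le> B\<^sup>2"
proof -
  obtain m g l where m: "m < n"
    and g: "\<And>j. j < m \<Longrightarrow> g j \<in> borel_measurable torus_measure" "\<And>j. j < m \<Longrightarrow> Linf_norm (g j) < \<infinity>"
    and l: "\<And>j. j < m \<Longrightarrow> bounded_lin_functional s r (l j)"
    and A_eq: "\<And>f x. A f x = (\<Sum>j<m. l j f * g j x)"
    using A unfolding finite_rank_op_def by blast
  define W where "W = (mix_weight s r :: int^'d \<Rightarrow> real)"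
  have W: "0 < W k" for k unfolding W_def by (rule weight_pos)
  \<comment> \<open>\<open>U k\<close> is the error of \<open>A\<close> at the character
    \<open>chr k\<close>.\<close>
  define U where "U k x = chr k x - (\<Sum>j<m. l j (chr k) * g j x)" for k and x
  have U_meas: "U k \<in> borel_measurable torus_measure" for k
    unfolding U_def[abs_def] using g(1) by (intro borel_measurable_diff borel_measurable_sum borel_measurable_times) auto
  have g_bd: "\<exists>C. AE x in torus_measure. cmod (g j x) \<le> C" if "j < m" for j
  proof (cases "Linf_norm (g j)")
    case (real C)
    thus ?thesis using esssup_AE[of "\<lambda>x. ereal (cmod (g j x))" torus_measure] unfolding Linf_norm_def by auto
  next
    case PInf
    thus ?thesis using g(2)[OF that] by simp
  next
    \<comment> \<open>An essential supremum in \<open>ereal\<close> may formally be minus infinity;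
      any real bound then serves.\<close>
    case MInf
    have "AE x in torus_measure. ereal (cmod (g j x)) \<le> - \<infinity>"
      using esssup_AE[of "\<lambda>x. ereal (cmod (g j x))" torus_measure] MInf unfolding Linf_norm_def by simp
    hence "AE x in torus_measure. cmod (g j x) \<le> 0" by eventually_elim simp
    thus ?thesis by blast
  qed
  then obtain C where C: "\<And>j. j < m \<Longrightarrow> AE x in torus_measure. cmod (g j x) \<le> C j" by metis
  have g_L2: "L2_torus (g j)" if "j < m" for j by (rule L2_torus_bounded[OF g(1)[OF that] C[OF that]])
  have AE_C: "AE x in torus_measure. \<forall>j\<in>{..<m}. cmod (g j x) \<le> C j"
    using C by (intro AE_ball_countable') auto
  have U_L2: "L2_torus (U k)" for k
  proof (rule L2_torus_bounded[OF U_meas])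
    show "AE x in torus_measure. cmod (U k x) \<le> 1 + (\<Sum>j<m. cmod (l j (chr k)) * C j)"
      using AE_C
    proof eventually_elim
      case (elim x)
      have "cmod (U k x) \<le> cmod (chr k x) + cmod (\<Sum>j<m. l j (chr k) * g j x)"
        unfolding U_def by (rule norm_triangle_ineq4)
      also have "cmod (\<Sum>j<m. l j (chr k) * g j x) \<le> (\<Sum>j<m. cmod (l j (chr k)) * C j)"
        using elim by (intro order.trans[OF norm_sum] sum_mono) (auto simp: norm_mult intro!: mult_left_mono)
      finally show ?case by simp
    qed
  qed
  have U_coeff: "fcoeff (U k) j = (if j = k then 1 else 0) - (\<Sum>i<m. l i (chr k) * fcoeff (g i) j)" for k j
  proof -
    have "integrable torus_measure (\<lambda>x. \<Sum>i<m. l i (chr k) * g i x)"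
      using L2_torus_integrable[OF g_L2] by (intro Bochner_Integration.integrable_sum integrable_mult_right) auto
    from fcoeff_linear[OF integrable_chr[of k] this, of 1 "-1" j]
    have "fcoeff (U k) j = fcoeff (chr k) j - fcoeff (\<lambda>x. \<Sum>i<m. l i (chr k) * g i x) j"
      by (simp add: U_def[abs_def])
    also have "fcoeff (\<lambda>x. \<Sum>i<m. l i (chr k) * g i x) j = (\<Sum>i<m. l i (chr k) * fcoeff (g i) j)"
      using L2_torus_integrable[OF g_L2] by (intro fcoeff_sum) auto
    finally show ?thesis by (auto simp: fcoeff_chr)
  qed
  \<comment> \<open>The combination is rescaled by its norm \<open>\<rho>\<close> to enter the unit
    ball; \<open>\<rho> = 0\<close> forces all coefficients on \<open>F\<close> to vanish because
    the weights are positive.\<close>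
  have error: "AE x in torus_measure. (cmod (\<Sum>k\<in>F. c k * U k x))\<^sup>2 \<le> B\<^sup>2 * (\<Sum>k\<in>F. W k * (cmod (c k))\<^sup>2)"
    if F: "finite F" for F c
  proof -
    define \<rho> where "\<rho> = sqrt (\<Sum>k\<in>F. W k * (cmod (c k))\<^sup>2)"
    have nn: "0 \<le> W k * (cmod (c k))\<^sup>2" for k using W[of k] by simp
    have \<rho>2: "\<rho>\<^sup>2 = (\<Sum>k\<in>F. W k * (cmod (c k))\<^sup>2)" unfolding \<rho>_def using nn by (simp add: sum_nonneg)
    show ?thesis
    proof (cases "\<rho> = 0")
      case True
      hence "(\<Sum>k\<in>F. W k * (cmod (c k))\<^sup>2) = 0" using \<rho>2 by simp
      hence "W k * (cmod (c k))\<^sup>2 = 0" if "k \<in> F" for k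
        using that F nn by (subst (asm) sum_nonneg_eq_0_iff) auto
      hence "c k = 0" if "k \<in> F" for k using that W by (metis less_irrefl mult_eq_0_iff norm_eq_zero power_eq_0_iff)
      thus ?thesis by simp
    next
      case False
      hence \<rho>: "0 < \<rho>" unfolding \<rho>_def using nn by (simp add: sum_nonneg less_le)
      define f :: "real^'d \<Rightarrow> complex" where "f x = (\<Sum>k\<in>F. c k / \<rho> * chr k x)" for x
      have f: "f \<in> Hmix s r" unfolding f_def[abs_def] by (rule Hmix_trig_sum(1)[OF F])
      have "(Hmix_norm s r f)\<^sup>2 = (\<Sum>k\<in>F. W k * (cmod (c k / \<rho>))\<^sup>2)"
        unfolding f_def[abs_def] W_def by (rule Hmix_trig_sum(2)[OF F])
      also have "\<dots> = (\<Sum>k\<in>F. W k * (cmod (c k))\<^sup>2) / \<rho>\<^sup>2"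
        by (simp add: norm_divide power_divide sum_divide_distrib)
      also have "\<dots> = 1" using \<rho> unfolding \<rho>2[symmetric] by simp
      finally have "Hmix_norm s r f \<le> 1" using power2_le_imp_le[of "Hmix_norm s r f" 1] by simp
      from bound[OF f this] have le: "Linf_norm (\<lambda>x. f x - A f x) \<le> ereal B" .
      have "AE x in torus_measure. ereal (cmod (f x - A f x)) \<le> ereal B"
        using esssup_AE[of "\<lambda>x. ereal (cmod (f x - A f x))" torus_measure]
      proof eventually_elim
        case (elim x)
        thus ?case using le unfolding Linf_norm_def by (rule order.trans)
      qed
      thus ?thesis
      proof eventually_elim
        case (elim x)
        have "A f x = (\<Sum>j<m. (\<Sum>k\<in>F. c k / \<rho> * l j (chr k)) * g j x)"
          unfolding A_eq f_def[abs_def] by (intro sum.cong arg_cong2[where f = "(*)"] bounded_lin_functional_sum l F) auto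
        also have "\<dots> = (\<Sum>k\<in>F. c k / \<rho> * (\<Sum>j<m. l j (chr k) * g j x))"
          unfolding sum_distrib_right sum_distrib_left by (subst sum.swap) (simp add: mult.assoc)
        finally have "f x - A f x = (\<Sum>k\<in>F. c k / \<rho> * U k x)"
          by (simp add: f_def U_def right_diff_distrib sum_subtractf)
        also have "\<dots> = (\<Sum>k\<in>F. c k * U k x) / \<rho>" by (simp add: sum_divide_distrib)
        finally have "cmod (\<Sum>k\<in>F. c k * U k x) / \<rho> \<le> B" using elim \<rho> by (simp add: norm_divide)
        hence "cmod (\<Sum>k\<in>F. c k * U k x) \<le> B * \<rho>" using \<rho> by (simp add: field_simps)
        hence "(cmod (\<Sum>k\<in>F. c k * U k x))\<^sup>2 \<le> (B * \<rho>)\<^sup>2" by (intro power_mono) auto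
        thus ?case by (simp add: power_mult_distrib \<rho>2)
      qed
    qed
  qed
  \<comment> \<open>The null set in \<open>error\<close> depends on \<open>c\<close>. Countably many
    coefficient families leave one common null set, off which the density argument runs at each
    fixed x.\<close>
  have pointwise: "AE x in torus_measure. (\<Sum>k\<in>F. (cmod (U k x))\<^sup>2 / W k) \<le> B\<^sup>2" if F: "finite F" for F
  proof -
    obtain Q :: "complex set" where Q: "countable Q" "\<And>X. open X \<Longrightarrow> X \<noteq> {} \<Longrightarrow> \<exists>d\<in>Q. d \<in> X"
      by (rule countable_dense_setE) blast
    have "AE x in torus_measure. \<forall>c\<in>F \<rightarrow>\<^sub>E Q. (cmod (\<Sum>k\<in>F. c k * U k x))\<^sup>2 \<le> B\<^sup>2 * (\<Sum>k\<in>F. W k * (cmod (c k))\<^sup>2)"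
      using F Q(1) by (intro AE_ball_countable' error countable_PiE) auto
    thus ?thesis
    proof eventually_elim
      case (elim x)
      show ?case using F Q(2) W elim by (intro dense_coefficients_bound[where F = F and Q = Q and W = W and u = "\<lambda>k. U k x"]) auto
    qed
  qed
  define P where "P = (2 * pi) ^ CARD('d)"
  have P: "0 < P" unfolding P_def by simp
  have U_sq: "integrable torus_measure (\<lambda>x. (cmod (U k x))\<^sup>2)" for k using U_L2 by (simp add: L2_torus_def)
  \<comment> \<open>The volume \<open>P\<close> of the torus on the right cancels against the factor
    in Bessel's inequality.\<close>
  have integrated: "(\<Sum>k\<in>F. (1 / W k) * (\<Sum>j\<in>F. (cmod (fcoeff (U k) j))\<^sup>2)) \<le> B\<^sup>2" if F: "finite F" for F
  proof -
    have "P * (\<Sum>k\<in>F. (1 / W k) * (\<Sum>j\<in>F. (cmod (fcoeff (U k) j))\<^sup>2))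
        = (\<Sum>k\<in>F. (1 / W k) * (P * (\<Sum>j\<in>F. (cmod (fcoeff (U k) j))\<^sup>2)))"
      by (simp add: sum_distrib_left mult_ac)
    also have "\<dots> \<le> (\<Sum>k\<in>F. (1 / W k) * integral\<^sup>L torus_measure (\<lambda>x. (cmod (U k x))\<^sup>2))"
      using W unfolding P_def by (intro sum_mono mult_left_mono bessel_torus U_L2 F) (simp add: less_imp_le)
    also have "\<dots> = integral\<^sup>L torus_measure (\<lambda>x. \<Sum>k\<in>F. (cmod (U k x))\<^sup>2 / W k)"
      using U_sq by simp
    also have "\<dots> \<le> integral\<^sup>L torus_measure (\<lambda>x :: real^'d. B\<^sup>2)"
      using U_sq by (intro integral_mono_AE pointwise F) auto
    also have "\<dots> = P * B\<^sup>2" using measure_torus[where 'd = 'd] by (simp add: P_def)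
    finally show ?thesis using P by simp
  qed
  define L where "L = e ` {..<n - 1}"
  define t where "t = 1 / W (e (n - 1))"
  have inj: "inj e" using bij_e by (simp add: bij_def)
  have partial: "(\<Sum>j<N. 1 / W (e (j + (n - 1)))) \<le> B\<^sup>2" for N
  proof -
    \<comment> \<open>The first N + (n - 1) frequencies: \<open>L\<close> holds the n - 1 lightest,
      the other N give the partial sum of the tail.\<close>
    define F where "F = e ` {..<N + (n - 1)}"
    have F: "finite F" "L \<subseteq> F" unfolding F_def L_def by auto
    have FL: "F - L = e ` {n - 1..<N + (n - 1)}"
      unfolding F_def L_def image_set_diff[OF inj, symmetric] by (intro arg_cong[of _ _ "image e"]) auto
    obtain p where p: "\<And>k. k \<in> F \<Longrightarrow> 0 \<le> p k \<and> p k \<le> 1" "(\<Sum>k\<in>F. p k) \<le> real m"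
      "\<And>k a. k \<in> F \<Longrightarrow> 1 - p k \<le> (\<Sum>j\<in>F. (cmod ((if j = k then 1 else 0) - (\<Sum>i<m. a i * fcoeff (g i) j)))\<^sup>2)"
      using finite_rank_distance[OF F(1), where G = "\<lambda>i. fcoeff (g i)" and m = m] by blast
    have "(\<Sum>j<N. 1 / W (e (j + (n - 1)))) = (\<Sum>i\<in>{n - 1..<N + (n - 1)}. 1 / W (e i))"
      using sum.shift_bounds_nat_ivl[of "\<lambda>i. 1 / W (e i)" 0 "n - 1" N] by (simp add: atLeast0LessThan)
    also have "\<dots> = (\<Sum>k\<in>F - L. 1 / W k)"
      unfolding FL by (subst sum.reindex) (auto intro: inj_on_subset[OF inj])
    also have "\<dots> \<le> (\<Sum>k\<in>F. (1 / W k) * (1 - p k))"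
    \<comment> \<open>The reciprocal weight at index n - 1 separates \<open>L\<close> from the rest,
      since \<open>e\<close> is sorted. Rank below n means \<open>m\<close> is at most n - 1, the
      size of \<open>L\<close>.\<close>
    proof (rule bathtub_sum[where t = t and m = m])
      have "card L = n - 1" unfolding L_def by (simp add: card_image inj_on_subset[OF inj])
      thus "real m \<le> real (card L)" using m by simp
      show "t \<le> 1 / W k" if k: "k \<in> L" for k
      proof -
        obtain i where "k = e i" "i \<le> n - 1" using k unfolding L_def by auto
        thus ?thesis unfolding t_def using weight_mono[of i "n - 1"] W by (auto simp: W_def intro!: divide_left_mono)
      qed
      show "1 / W k \<le> t" if k: "k \<in> F - L" for k
      proof -
        obtain i where "k = e i" "n - 1 \<le> i" using k unfolding FL by auto
        thus ?thesis unfolding t_def using weight_mono[of "n - 1" i] W by (auto simp: W_def intro!: divide_left_mono)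
      qed
      show "0 \<le> t" unfolding t_def using W[of "e (n - 1)"] by simp
    qed (use F p in auto)
    also have "\<dots> \<le> (\<Sum>k\<in>F. (1 / W k) * (\<Sum>j\<in>F. (cmod (fcoeff (U k) j))\<^sup>2))"
      using p(3) W unfolding U_coeff by (intro sum_mono mult_left_mono) (auto simp: less_imp_le)
    also have "\<dots> \<le> B\<^sup>2" by (rule integrated[OF F(1)])
    finally show ?thesis .
  qed
  show ?thesis
    unfolding weight_tail_def using partial by (intro suminf_le_const weight_tail_summable) (simp add: W_def)
qed

lemma approx_number_eq:
  assumes n: "1 \<le> n"
  shows "approx_number TYPE('d) s r n = ereal (sqrt (weight_tail (n - 1)))"
proof (rule antisym)
  show "approx_number TYPE('d) s r n \<le> ereal (sqrt (weight_tail (n - 1)))" by (rule approx_number_upper[OF n])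
  show "ereal (sqrt (weight_tail (n - 1))) \<le> approx_number TYPE('d) s r n"
    unfolding approx_number_def
  proof (rule INF_greatest)
    fix A :: "(real^'d \<Rightarrow> complex) \<Rightarrow> real^'d \<Rightarrow> complex"
    assume "A \<in> {A. finite_rank_op s r n A}"
    hence A: "finite_rank_op s r n A" by simp
    define S where "S = (SUP f \<in> {f \<in> Hmix s r. Hmix_norm s r f \<le> 1}. Linf_norm (\<lambda>x. f x - A f x))"
    show "ereal (sqrt (weight_tail (n - 1))) \<le> (SUP f \<in> {f \<in> Hmix s r. Hmix_norm s r f \<le> 1}. Linf_norm (\<lambda>x. f x - A f x))"
      unfolding S_def[symmetric]
    proof (rule ccontr)
      assume "\<not> ereal (sqrt (weight_tail (n - 1))) \<le> S"
      hence "S < ereal (sqrt (weight_tail (n - 1)))" by simp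
      \<comment> \<open>The supremum \<open>S\<close> is an \<open>ereal\<close>; a real number
        strictly between it and the claimed value, raised to at least 0, serves as the error
        bound.\<close>
      then obtain b where b: "S < ereal b" "b < sqrt (weight_tail (n - 1))"
        using ereal_dense2 by (metis less_ereal.simps(1))
      define B where "B = max b 0"
      have B: "0 \<le> B" "B < sqrt (weight_tail (n - 1))" using b weight_tail_pos[of "n - 1"] by (auto simp: B_def)
      have "S \<le> ereal B" using b(1) unfolding B_def by (meson ereal_less_eq(3) less_imp_le max.cobounded1 order.trans)
      hence "Linf_norm (\<lambda>x. f x - A f x) \<le> ereal B" if "f \<in> Hmix s r" "Hmix_norm s r f \<le> 1" for f
        using that unfolding S_def by (auto simp: SUP_le_iff)
      from finite_rank_error_bound[OF A n B(1) this] have "weight_tail (n - 1) \<le> B\<^sup>2" by blast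
      hence "sqrt (weight_tail (n - 1)) \<le> B" using B(1) real_sqrt_le_mono[of "weight_tail (n - 1)" "B\<^sup>2"] by simp
      thus False using B(2) by simp
    qed
  qed
qed

end

section \<open>Asymptotics\<close>

lemma mix_weight1_bounds:
  assumes "0 < r"
  shows "1 \<le> mix_weight1 r k" and "\<bar>real_of_int k\<bar> \<le> mix_weight1 r k"
proof -
  have "max 1 \<bar>real_of_int k\<bar> \<le> mix_weight1 r k"
  proof (cases "r = \<infinity>")
    case False
    define \<rho> where "\<rho> = real_of_ereal r"
    have \<rho>: "0 < \<rho>" using assms False unfolding \<rho>_def by (cases r) auto
    have "1 = 1 powr (1 / \<rho>)" by simp
    also have "\<dots> \<le> (1 + \<bar>real_of_int k\<bar> powr \<rho>) powr (1 / \<rho>)"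
      using \<rho> by (intro powr_mono2) auto
    finally have 1: "1 \<le> (1 + \<bar>real_of_int k\<bar> powr \<rho>) powr (1 / \<rho>)" .
    have "\<bar>real_of_int k\<bar> = (\<bar>real_of_int k\<bar> powr \<rho>) powr (1 / \<rho>)"
      using \<rho> by (simp add: powr_powr)
    also have "\<dots> \<le> (1 + \<bar>real_of_int k\<bar> powr \<rho>) powr (1 / \<rho>)"
      using \<rho> by (intro powr_mono2) auto
    finally show ?thesis using 1 False by (simp add: mix_weight1_def \<rho>_def)
  qed (simp add: mix_weight1_def)
  thus "1 \<le> mix_weight1 r k" and "\<bar>real_of_int k\<bar> \<le> mix_weight1 r k" by auto
qed

text \<open>All the weights are asymptotic to k, whichever r is chosen; this is why the limit
  constant is the same for every r.\<close>

lemma mix_weight1_asymp: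
  assumes "0 < r"
  shows "(\<lambda>k. mix_weight1 r (int k) / real k) \<longlonglongrightarrow> 1"
proof (cases "r = \<infinity>")
  case True
  have "eventually (\<lambda>k. 1 = mix_weight1 r (int k) / real k) sequentially"
    using eventually_gt_at_top[of 0] by eventually_elim (simp add: mix_weight1_def True)
  thus ?thesis by (rule Lim_transform_eventually[OF tendsto_const])
next
  case False
  define \<rho> where "\<rho> = real_of_ereal r"
  have \<rho>: "0 < \<rho>" using assms False unfolding \<rho>_def by (cases r) auto
  have "(\<lambda>k. (1 + real k powr \<rho>) powr (1 / \<rho>) / real k) \<longlonglongrightarrow> 1"
    using \<rho> by real_asymp
  thus ?thesis using False by (simp add: mix_weight1_def \<rho>_def)
qed

lemma infinite_UNIV_int_vec: "infinite (UNIV :: (int^'d) set)"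
proof
  assume "finite (UNIV :: (int^'d) set)"
  moreover have "inj (\<lambda>m :: int. (\<chi> i. m) :: int^'d)" by (auto simp: inj_def vec_eq_iff)
  ultimately have "finite (UNIV :: int set)" by (metis finite_imageD finite_subset subset_UNIV)
  thus False by simp
qed

theorem theorem4:
  fixes s :: real and r :: ereal
  assumes "s > 1/2" and "0 < r"
  shows "(\<lambda>n::nat. real n powr (s - 1/2) * real_of_ereal (approx_number TYPE('d::finite) s r n)
             / ln (real n) powr (real (CARD('d) - 1) * s))
         \<longlonglongrightarrow> (1 / sqrt (2 * s - 1)) * (2 ^ CARD('d) / fact (CARD('d) - 1)) powr s"
proof -
  define c where "c k = mix_weight1 r (int k)" for k
  \<comment> \<open>Counting is done for the product without the exponent 2s; since powers with
    positive exponent preserve order, the same enumeration sorts the squared weights.\<close>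
  define V where "V k = (\<Prod>j\<in>UNIV. c (nat \<bar>k $ j\<bar>))" for k :: "int^'d"
  define p where "p = CARD('d) - 1"
  define K :: real where "K = 2 ^ CARD('d) / fact p"
  have card: "CARD('d) = Suc p" unfolding p_def by simp
  have K: "0 < K" by (simp add: K_def)
  have c_ge: "1 \<le> c k" "real k \<le> c k" for k
    using mix_weight1_bounds[OF assms(2), of "int k"] by (auto simp: c_def)
  have c_abs: "mix_weight1 r m = c (nat \<bar>m\<bar>)" for m by (simp add: c_def mix_weight1_def)
  have V_ge: "1 \<le> V k" for k unfolding V_def by (intro prod_ge_1 c_ge)
  have weight: "mix_weight s r k = V k powr (2 * s)" for k :: "int^'d"
    unfolding mix_weight_def V_def c_abs
    using c_ge(1) by (intro prod_powr_distrib[symmetric])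
  have fin: "finite {k. V k \<le> R}" for R
    unfolding V_def by (rule card_lattice_points(1)[OF c_ge])
  have count: "((\<lambda>R. real (card {k. V k \<le> R}) / (R * ln R ^ p)) \<longlongrightarrow> K) at_top"
    using lattice_count_asymp[of c p, OF c_ge] mix_weight1_asymp[OF assms(2)] card_lattice_points(2)[of c, OF c_ge, where 'd = 'd]
    unfolding V_def K_def card c_def by simp
  obtain e :: "nat \<Rightarrow> int^'d" where e: "bij e" "\<And>m n. m \<le> n \<Longrightarrow> V (e m) \<le> V (e n)"
    using ex_sorted_enumeration[of V, OF infinite_UNIV_int_vec fin] by blast
  note enum = enumeration_asymp[of e V, OF e fin count K]
  \<comment> \<open>Raising n / (V (e n) (ln n)^p) -> K to the power 2s gives the growth of the
    reciprocal weights, with constant K^(2s).\<close>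
  have "(\<lambda>n. (real n / (V (e n) * ln (real n) ^ p)) powr (2 * s)) \<longlonglongrightarrow> K powr (2 * s)"
    using K by (intro tendsto_powr enum(2) tendsto_const) auto
  moreover have "eventually (\<lambda>n. (real n / (V (e n) * ln (real n) ^ p)) powr (2 * s)
      = 1 / mix_weight s r (e n) / (real n powr (- (2 * s)) * ln (real n) powr (real p * (2 * s)))) sequentially"
    using eventually_gt_at_top[of 1]
  proof eventually_elim
    case (elim n)
    have "ln (real n) ^ p = ln (real n) powr real p" using elim by (simp add: powr_realpow)
    thus ?case using elim V_ge[of "e n"]
      by (simp add: weight powr_divide powr_mult powr_powr powr_minus field_simps)
  qed
  ultimately have x: "(\<lambda>n. 1 / mix_weight s r (e n) / (real n powr (- (2 * s)) * ln (real n) powr (real p * (2 * s))))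
      \<longlonglongrightarrow> K powr (2 * s)" by (rule Lim_transform_eventually)
  \<comment> \<open>Here s > 1/2 enters as convergence of the tail sums.\<close>
  have \<sigma>: "1 < 2 * s" "0 \<le> real p * (2 * s)" using assms(1) by auto
  note tail = power_log_tail_sum_asymp[OF \<sigma> x]
  have weight_ge: "1 \<le> mix_weight s r k" for k :: "int^'d"
    unfolding weight using V_ge[of k] assms(1) by (simp add: ge_one_powr_ge_zero)
  have weight_mono: "mix_weight s r (e i) \<le> mix_weight s r (e j)" if "i \<le> j" for i j
    unfolding weight using e(2)[OF that] V_ge[of "e i"] assms(1) by (intro powr_mono2) auto
  define T where "T n = (\<Sum>j. 1 / mix_weight s r (e (j + (n - 1))))" for n
  \<comment> \<open>For n = 0 no operator qualifies and the infimum is infinite, so the formula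
    starts at n = 1; the limit is unaffected.\<close>
  have approx: "approx_number TYPE('d) s r n = ereal (sqrt (T n))" if "1 \<le> n" for n
    using approx_number_eq[OF e(1) weight_ge weight_mono tail(1) that]
      weight_tail_def[OF e(1) weight_ge weight_mono tail(1)] by (simp add: T_def)
  have "(\<lambda>n. sqrt (T n / (real n powr (1 - 2 * s) * ln (real n) powr (real p * (2 * s)))))
      \<longlonglongrightarrow> sqrt (K powr (2 * s) / (2 * s - 1))"
    using tail(2) unfolding T_def by (rule tendsto_real_sqrt)
  moreover have "eventually (\<lambda>n. sqrt (T n / (real n powr (1 - 2 * s) * ln (real n) powr (real p * (2 * s))))
      = real n powr (s - 1/2) * real_of_ereal (approx_number TYPE('d) s r n) / ln (real n) powr (real p * s)) sequentially"
    using eventually_gt_at_top[of 1]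
  proof eventually_elim
    case (elim n)
    have "real n powr (1 - 2 * s) = (real n powr (1/2 - s))\<^sup>2"
      using elim by (simp add: powr_power algebra_simps)
    hence 1: "sqrt (real n powr (1 - 2 * s)) = real n powr (1/2 - s)" by simp
    have "ln (real n) powr (real p * (2 * s)) = (ln (real n) powr (real p * s))\<^sup>2"
      using elim by (simp add: powr_power algebra_simps)
    hence 2: "sqrt (ln (real n) powr (real p * (2 * s))) = ln (real n) powr (real p * s)" by simp
    have "real n powr (s - 1/2) * real n powr (1/2 - s) = 1"
      using elim by (simp flip: powr_add)
    hence 3: "real n powr (s - 1/2) = 1 / real n powr (1/2 - s)" using elim by (simp add: field_simps)
    show ?case using elim by (simp only: real_sqrt_divide real_sqrt_mult 1 2 3) (simp add: approx)
  qed
  ultimately have "(\<lambda>n. real n powr (s - 1/2) * real_of_ereal (approx_number TYPE('d) s r n)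
      / ln (real n) powr (real p * s)) \<longlonglongrightarrow> sqrt (K powr (2 * s) / (2 * s - 1))"
    by (rule Lim_transform_eventually)
  moreover have "sqrt (K powr (2 * s) / (2 * s - 1)) = 1 / sqrt (2 * s - 1) * K powr s"
  proof -
    have "K powr (2 * s) = (K powr s)\<^sup>2" using K by (simp add: powr_power mult.commute)
    thus ?thesis by (simp add: real_sqrt_divide)
  qed
  ultimately show ?thesis by (simp add: K_def p_def)
qed

end
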